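(* Let $\{\mathcal{T}(t)\}_{t\ge 0}$ be the asymmetric telegraph process with velocities $c_1,-c_2$ ($c_1,c_2>0$) and rate $\lambda>0$, and let $t>0$. For every integer $k\ge 0$ and every $\beta\in[0,c_1t]$, $$P\Big\{\max_{0\le s\le t}\mathcal{T}(s)\le\beta\ \Big|\ V(0)=-c_2,\ N(t)=2k+1\Big\}=\sum_{j=0}^{k}\binom{2k+1}{j}\frac{(c_1t-\beta)^{j}(c_2t+\beta)^{2k+1-j}}{[(c_1+c_2)t]^{2k+1}}-\sum_{j=0}^{k-1}\binom{2k+1}{j}\Big(\frac{c_2}{c_1}\Big)^{2k-2j}\frac{(c_1t-\beta)^{2k+1-j}(c_2t+\beta)^{j}}{[(c_1+c_2)t]^{2k+1}}.$$
   Context: Asymmetric telegraph process: let $c_1,c_2>0$, $\lambda>0$. Let $\{N(t)\}_{t\ge0}$ be a homogeneous Poisson process with rate $\lambda$, and let $V(0)$ be a random variable independent of $N$ with $P\{V(0)=c_1\}=P\{V(0)=-c_2\}=\frac12$. The velocity $V(s)$ takes values in $\{c_1,-c_2\}$, starts at $V(0)$, and switches from one of these two values to the other at each event of $N$, remaining constant between events. The position of the particle is $\mathcal{T}(t)=\int_0^t V(s)\,ds$ (so $\mathcal{T}(0)=0$). Empty sums are $0$, and $0^0=1$. *)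

theory Defs
  imports "HOL-Probability.Probability"
begin

text \<open>
  Only the values \<open>N t\<close> for \<open>t \<ge> 0\<close> are meaningful. The path properties hold for every
  \<open>\<omega>\<close>, so the truncated subtraction of \<open>nat\<close> in the increments is the true difference.
  That jumps have size one holds almost surely as a consequence of the Poisson increments.
\<close>
definition poisson_process :: "'a measure \<Rightarrow> real \<Rightarrow> (real \<Rightarrow> 'a \<Rightarrow> nat) \<Rightarrow> bool" where
  "poisson_process M rate N \<longleftrightarrow>
     prob_space M \<and> rate > 0 \<and>
     (\<forall>t\<ge>0. N t \<in> measurable M (count_space UNIV)) \<and>
     (\<forall>\<omega>\<in>space M. N 0 \<omega> = 0 \<and> mono_on {0..} (\<lambda>t. N t \<omega>) \<and>
        (\<forall>t\<ge>0. continuous (at_right t) (\<lambda>s. N s \<omega>))) \<and>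
     (\<forall>(\<tau> :: nat \<Rightarrow> real) n. 0 \<le> \<tau> 0 \<and> mono_on {..n} \<tau> \<longrightarrow>
        prob_space.indep_vars M (\<lambda>_. count_space UNIV)
          (\<lambda>i \<omega>. N (\<tau> (Suc i)) \<omega> - N (\<tau> i) \<omega>) {..<n}) \<and>
     (\<forall>s t. 0 \<le> s \<and> s < t \<longrightarrow>
        distr M (count_space UNIV) (\<lambda>\<omega>. N t \<omega> - N s \<omega>)
          = measure_pmf (poisson_pmf (rate * (t - s))))"

definition switch_velocity :: "real \<Rightarrow> real \<Rightarrow> real \<Rightarrow> real" where
  "switch_velocity c1 c2 v = (if v = c1 then - c2 else c1)"

definition telegraph_velocity ::
    "real \<Rightarrow> real \<Rightarrow> ('a \<Rightarrow> real) \<Rightarrow> (real \<Rightarrow> 'a \<Rightarrow> nat) \<Rightarrow> real \<Rightarrow> 'a \<Rightarrow> real" where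
  "telegraph_velocity c1 c2 V0 N s \<omega> = (switch_velocity c1 c2 ^^ N s \<omega>) (V0 \<omega>)"

text \<open>
  For \<open>\<omega> \<in> space M\<close> the velocity is a bounded step function on compact intervals, so the
  position is continuous in time and its supremum over \<open>{0..t}\<close> is a maximum.
\<close>
definition telegraph_position ::
    "real \<Rightarrow> real \<Rightarrow> ('a \<Rightarrow> real) \<Rightarrow> (real \<Rightarrow> 'a \<Rightarrow> nat) \<Rightarrow> real \<Rightarrow> 'a \<Rightarrow> real" where
  "telegraph_position c1 c2 V0 N t \<omega> =
     integral {0..t} (\<lambda>s. telegraph_velocity c1 c2 V0 N s \<omega>)"

text \<open>
  Independence of \<open>V0\<close> and \<open>N\<close> means independence of \<open>V0\<close> and the whole family
  \<open>(N t)\<close>, \<open>t \<ge> 0\<close>, viewed as one random element of the product space. It is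
  expressed by the generated sigma-algebras, since \<open>indep_var\<close> requires both variables to
  have the same value type.
\<close>
definition telegraph_process ::
    "'a measure \<Rightarrow> real \<Rightarrow> real \<Rightarrow> real \<Rightarrow> ('a \<Rightarrow> real) \<Rightarrow> (real \<Rightarrow> 'a \<Rightarrow> nat) \<Rightarrow> bool" where
  "telegraph_process M c1 c2 rate V0 N \<longleftrightarrow>
     c1 > 0 \<and> c2 > 0 \<and>
     poisson_process M rate N \<and>
     V0 \<in> borel_measurable M \<and>
     measure M {\<omega> \<in> space M. V0 \<omega> = c1} = 1 / 2 \<and>
     measure M {\<omega> \<in> space M. V0 \<omega> = - c2} = 1 / 2 \<and>
     prob_space.indep_set M
       (sets (vimage_algebra (space M) V0 borel))
       (sets (vimage_algebra (space M) (\<lambda>\<omega>. \<lambda>t\<in>{0..}. N t \<omega>)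
          (PiM {0..} (\<lambda>_. count_space UNIV))))"

end

theory Submission
  imports Defs
begin

text \<open>
  Write \<open>C = c1 + c2\<close>, \<open>r = c2 / c1\<close>, and replace the time \<open>t\<close> and the level \<open>\<beta>\<close> by the
  coordinates \<open>a = c1 * t - \<beta>\<close> and \<open>b = c2 * t + \<beta>\<close>, so that \<open>a + b = C * t\<close>. While the
  particle moves down for a time \<open>s\<close>, the remaining time shrinks by \<open>s\<close> and the distance to the
  level grows by \<open>c2 * s\<close>: the point \<open>(a, b)\<close> moves to \<open>(a - C * s, b)\<close>. While it moves up,
  \<open>(a, b)\<close> moves to \<open>(a, b - C * s)\<close>. Each direction of motion thus changes only one coordinate.

  Let \<open>D n\<close> and \<open>U n\<close> be \<open>(C * t) ^ n\<close> times the probability, given \<open>n\<close> jumps in \<open>[0, t]\<close>,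
  that the particle never exceeds \<open>\<beta>\<close>, for a start with downward and with upward velocity.
  Conditioning on the first jump gives \<open>\<partial>D n / \<partial>a = n * U (n - 1)\<close> and
  \<open>\<partial>U n / \<partial>b = n * D (n - 1)\<close>. The boundary values are \<open>D n = b ^ n\<close> at \<open>a = 0\<close>, where the level
  is out of reach, and \<open>U n = 0\<close> at \<open>b = r * a\<close>, that is at \<open>\<beta> = 0\<close>, where a particle that starts
  upwards crosses the level at once. From \<open>D 1 = b\<close> the two equations determine \<open>U 2\<close>, \<open>D 3\<close>,
  \<open>U 4\<close>, and so on. The solutions are a truncated binomial expansion of \<open>(a + b) ^ n\<close> minus a
  reflected copy, namely such an expansion evaluated at \<open>(b / r\<^sup>2, a)\<close> and scaled by a power of
  \<open>r\<close>; the subtraction is what makes \<open>U n\<close> vanish on \<open>b = r * a\<close>. They are the polynomials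
  \<open>down_poly\<close> and \<open>up_poly\<close> below.

  No distribution of jump times is computed. After a deterministic time \<open>h\<close>, the increments of a
  Poisson process form a Poisson process with the same rate (\<open>poisson_process_restart\<close>) that is
  independent of the number of jumps up to \<open>h\<close> (\<open>stay_prob_after_restart\<close>). Distinguishing
  whether no jump, one jump or more jumps occur before \<open>h\<close> gives upper and lower bounds
  for \<open>D n\<close> and \<open>U n\<close> (\<open>stay_volume_step\<close>), which differ by \<open>o(h)\<close> once \<open>U (n - 1)\<close> and
  \<open>D (n - 1)\<close> are known to be continuous. Adding up these bounds over steps of length \<open>h\<close> along
  the line on which the particle keeps its initial velocity, and letting \<open>h\<close> tend to \<open>0\<close>, yields the exact value (\<open>stay_volume_along_characteristic\<close>). The induction is carried out for
  all Poisson processes with the given rate on the probability space at once, because each step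
  passes to restarted processes.
\<close>

section \<open>Paths of a two-speed motion\<close>

locale telegraph_speeds =
  fixes c1 c2 :: real
  assumes c1_pos: "c1 > 0" and c2_pos: "c2 > 0"
begin

definition vel :: "nat \<Rightarrow> real" where
  "vel n = (if even n then - c2 else c1)"

text \<open>
  The number \<open>d\<close> enters only through its parity and fixes the initial direction: down for
  \<open>d = 0\<close>, up for \<open>d = 1\<close>. Keeping it apart from the counting path \<open>m\<close> lets a restarted path
  begin at \<open>0\<close> again.
\<close>
definition disp :: "nat \<Rightarrow> (real \<Rightarrow> nat) \<Rightarrow> real \<Rightarrow> real" where
  "disp d m s = integral {0..s} (\<lambda>u. vel (d + m u))"

definition stays_below :: "nat \<Rightarrow> (real \<Rightarrow> nat) \<Rightarrow> real \<Rightarrow> real \<Rightarrow> bool" where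
  "stays_below d m t \<beta> \<longleftrightarrow> (\<forall>s\<in>{0..t}. disp d m s \<le> \<beta>)"

lemma vel_bounds: "- c2 \<le> vel n" "vel n \<le> c1"
  using c1_pos c2_pos by (auto simp: vel_def)

text \<open>
  Only values of the path at nonnegative times are meaningful, so it is extended by its value at
  \<open>0\<close>; the extension is monotone on the whole line and therefore Borel measurable.
\<close>
lemma vel_borel_measurable:
  assumes m: "mono_on {0..} (m :: real \<Rightarrow> nat)"
  shows "(\<lambda>u. vel (d + m (max 0 u))) \<in> borel_measurable borel"
proof -
  have "mono (\<lambda>u. real (m (max 0 u)))"
    using m by (auto intro!: monoI simp: mono_on_def)
  then have [measurable]: "(\<lambda>u. real (m (max 0 u))) \<in> borel_measurable borel"
    by (rule borel_measurable_mono)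
  have "(\<lambda>u. vel (d + nat \<lfloor>real (m (max 0 u))\<rfloor>)) \<in> borel_measurable borel"
    unfolding vel_def by measurable
  then show ?thesis
    by simp
qed

lemma vel_set_integrable:
  assumes m: "mono_on {0..} (m :: real \<Rightarrow> nat)"
  shows "set_integrable lborel {s..t} (\<lambda>u. vel (d + m (max 0 u)))"
  unfolding set_integrable_def
proof (rule integrableI_bounded_set_indicator)
  show "AE x in lborel. x \<in> {s..t} \<longrightarrow> norm (vel (d + m (max 0 x))) \<le> c1 + c2"
    using c1_pos c2_pos by (simp add: vel_def)
qed (use vel_borel_measurable[OF m] in \<open>auto simp: emeasure_lborel_Icc_eq\<close>)

lemma vel_integrable:
  assumes m: "mono_on {0..} (m :: real \<Rightarrow> nat)" and "0 \<le> s"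
  shows "(\<lambda>u. vel (d + m u)) integrable_on {s..t}"
proof (rule integrable_eq)
  show "(\<lambda>u. vel (d + m (max 0 u))) integrable_on {s..t}"
    by (rule set_borel_integral_eq_integral(1)[OF vel_set_integrable[OF m]])
qed (use \<open>0 \<le> s\<close> in auto)

lemma disp_eq_lebesgue_integral:
  assumes m: "mono_on {0..} m" and "0 \<le> s"
  shows "disp d m s = (LINT u:{0..s}|lborel. vel (d + m (max 0 u)))"
  using set_borel_integral_eq_integral(2)[OF vel_set_integrable[OF m]]
  by (auto simp: disp_def intro: integral_cong)

lemma disp_add:
  assumes m: "mono_on {0..} m" and "0 \<le> h" "0 \<le> u"
  shows "disp d m (h + u) = disp d m h + disp (d + m h) (\<lambda>v. m (h + v) - m h) u"
proof -
  have "disp d m (h + u) = disp d m h + integral {h..h + u} (\<lambda>u. vel (d + m u))"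
    unfolding disp_def
    by (rule Henstock_Kurzweil_Integration.integral_combine[symmetric])
       (use assms in \<open>auto intro: vel_integrable\<close>)
  also have "integral {h..h + u} (\<lambda>u. vel (d + m u)) = integral {0..u} (\<lambda>v. vel (d + m (v + h)))"
    using integral_shift_real_ivl[of h h "h + u" "\<lambda>u. vel (d + m u)"]
    by simp
  also have "\<dots> = disp (d + m h) (\<lambda>v. m (h + v) - m h) u"
    unfolding disp_def
  proof (rule integral_cong)
    fix v assume "v \<in> {0..u}"
    then have "m h \<le> m (h + v)"
      using m \<open>0 \<le> h\<close> by (auto simp: mono_on_def)
    then show "vel (d + m (v + h)) = vel (d + m h + (m (h + v) - m h))"
      by (simp add: add.commute)
  qed
  finally show ?thesis .
qed

lemma disp_bounds:
  assumes m: "mono_on {0..} m" and "0 \<le> s"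
  shows "- c2 * s \<le> disp d m s" "disp d m s \<le> c1 * s"
proof -
  have "integral {0..s} (\<lambda>_. - c2) \<le> disp d m s"
    unfolding disp_def by (rule integral_le) (use vel_bounds vel_integrable[OF m] in auto)
  then show "- c2 * s \<le> disp d m s"
    using \<open>0 \<le> s\<close> by (simp add: algebra_simps)
  have "disp d m s \<le> integral {0..s} (\<lambda>_. c1)"
    unfolding disp_def by (rule integral_le) (use vel_bounds vel_integrable[OF m] in auto)
  then show "disp d m s \<le> c1 * s"
    using \<open>0 \<le> s\<close> by (simp add: algebra_simps)
qed

lemma disp_constant_velocity:
  assumes "0 \<le> s" "\<And>u. 0 \<le> u \<Longrightarrow> u < s \<Longrightarrow> m u = n"
  shows "disp d m s = vel (d + n) * s"
proof -
  have "disp d m s = integral {0..s} (\<lambda>_. vel (d + n))"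
    unfolding disp_def
    by (rule integral_spike[where S="{s}"]) (use assms in auto)
  then show ?thesis
    using assms(1) by (simp add: mult.commute)
qed

lemma mono_on_shift:
  assumes m: "mono_on {0..} (m :: real \<Rightarrow> nat)" and "0 \<le> (h::real)"
  shows "mono_on {0..} (\<lambda>v. m (h + v) - m h)"
  using assms by (auto simp: mono_on_def intro!: diff_le_mono)

lemma disp_continuous:
  assumes m: "mono_on {0..} m"
  shows "continuous_on {0..t} (disp d m)"
  unfolding disp_def by (intro indefinite_integral_continuous_1 vel_integrable m) auto

text \<open>
  The Markov structure on the level of paths: what happens after \<open>h\<close> is again a motion of the same
  kind, seen from the position reached at \<open>h\<close>.
\<close>
lemma stays_below_split:
  assumes m: "mono_on {0..} m" and "0 \<le> h" "h \<le> t"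
  shows "stays_below d m t \<beta> \<longleftrightarrow>
    stays_below d m h \<beta> \<and>
    stays_below (d + m h) (\<lambda>v. m (h + v) - m h) (t - h) (\<beta> - disp d m h)"
proof -
  have *: "{0..t} = {0..h} \<union> (\<lambda>u. h + u) ` {0..t - h}"
    using \<open>0 \<le> h\<close> \<open>h \<le> t\<close> by (force simp: image_iff intro: bexI[of _ "x - h" for x])
  have "disp d m (h + u) \<le> \<beta> \<longleftrightarrow>
      disp (d + m h) (\<lambda>v. m (h + v) - m h) u \<le> \<beta> - disp d m h" if "u \<in> {0..t - h}" for u
    using disp_add[OF m \<open>0 \<le> h\<close>, of u d] that by auto
  then show ?thesis
    unfolding stays_below_def * ball_Un ball_simps by blast
qed

lemma stays_below_mono: "stays_below d m t \<beta> \<Longrightarrow> \<beta> \<le> \<beta>' \<Longrightarrow> stays_below d m t \<beta>'"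
  unfolding stays_below_def by fastforce

lemma stays_below_level_nonneg: "stays_below d m t \<beta> \<Longrightarrow> 0 \<le> t \<Longrightarrow> 0 \<le> \<beta>"
  unfolding stays_below_def by (auto dest!: bspec[of _ _ 0] simp: disp_def)

lemma stays_below_Suc_Suc: "stays_below (Suc (Suc d)) m t \<beta> = stays_below d m t \<beta>"
  by (simp add: stays_below_def disp_def vel_def)

lemma stays_below_trivial:
  assumes m: "mono_on {0..} m" and "c1 * t \<le> \<beta>"
  shows "stays_below d m t \<beta>"
  unfolding stays_below_def
proof
  fix s assume s: "s \<in> {0..t}"
  then have "disp d m s \<le> c1 * s" using disp_bounds[OF m] by auto
  also have "\<dots> \<le> c1 * t" using s c1_pos by (intro mult_left_mono) auto
  finally show "disp d m s \<le> \<beta>" using assms by simp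
qed

text \<open>
  On an initial interval without jumps the motion is linear, so its maximum there is attained at one
  of the endpoints. At time \<open>0\<close> the bound is \<open>0 \<le> \<beta>\<close>, and at time \<open>h\<close> it is contained in the
  condition on the restarted motion.
\<close>
lemma stays_below_no_jump:
  assumes m: "mono_on {0..} m" and ht: "0 \<le> h" "h \<le> t" and "m 0 = 0" "m h = 0" "0 \<le> \<beta>"
  shows "stays_below d m t \<beta> \<longleftrightarrow>
    stays_below d (\<lambda>v. m (h + v) - m h) (t - h) (\<beta> - vel d * h)"
proof -
  have m0: "m u = 0" if "0 \<le> u" "u \<le> h" for u
    using m that \<open>m h = 0\<close> ht by (metis atLeast_iff le_zero_eq mono_onD order_trans)
  have d: "disp d m s = vel d * s" if "s \<in> {0..h}" for s
    using disp_constant_velocity[of s m 0 d] that m0 by auto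
  have "stays_below d m h \<beta>" if "stays_below d (\<lambda>v. m (h + v) - m h) (t - h) (\<beta> - vel d * h)"
  proof -
    have "0 \<le> \<beta> - vel d * h"
      using stays_below_level_nonneg[OF that] ht by simp
    then have "vel d * s \<le> \<beta>" if "s \<in> {0..h}" for s
      using that \<open>0 \<le> \<beta>\<close> ht c1_pos c2_pos
      by (auto simp: vel_def intro: order_trans[of _ "c1 * h"] order_trans[of _ 0])
    then show ?thesis using d by (simp add: stays_below_def)
  qed
  then show ?thesis
    using stays_below_split[OF m ht, of d \<beta>] d[of h] ht \<open>m h = 0\<close> by auto
qed

text \<open>
  If jumps occur before \<open>h\<close>, the position at \<open>h\<close> is only known to lie in \<open>[- c2 * h, c1 * h]\<close>.
  The two ends of this interval give a necessary and a sufficient condition on the restarted motion.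
\<close>
lemma stays_below_after_jump:
  assumes m: "mono_on {0..} m" and ht: "0 \<le> h" "h \<le> t" and "stays_below d m t \<beta>"
  shows "stays_below (d + m h) (\<lambda>v. m (h + v) - m h) (t - h) (\<beta> + c2 * h)"
  using stays_below_split[OF m ht, of d \<beta>] disp_bounds(1)[OF m ht(1), of d] assms(4)
  by (auto elim: stays_below_mono)

lemma stays_below_before_jump:
  assumes m: "mono_on {0..} m" and ht: "0 \<le> h" "h \<le> t"
    and b: "stays_below (d + m h) (\<lambda>v. m (h + v) - m h) (t - h) (\<beta> - c1 * h)"
  shows "stays_below d m t \<beta>"
proof -
  have "0 \<le> \<beta> - c1 * h" using stays_below_level_nonneg[OF b] ht by simp
  then have "stays_below d m h \<beta>"
    by (intro stays_below_trivial[OF m]) simp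
  moreover have "stays_below (d + m h) (\<lambda>v. m (h + v) - m h) (t - h) (\<beta> - disp d m h)"
    using b disp_bounds(2)[OF m ht(1), of d] by (auto elim: stays_below_mono)
  ultimately show ?thesis using stays_below_split[OF m ht, of d \<beta>] by blast
qed

end

section \<open>Measurability of staying below a level\<close>

context telegraph_speeds begin

text \<open>
  By right-continuity, rounding the time up to a grid and refining the grid recovers the process, and
  on each grid only countably many of the random variables \<open>N u\<close> are involved.
\<close>
lemma vel_jointly_measurable:
  fixes N :: "real \<Rightarrow> 'a \<Rightarrow> nat"
  assumes meas: "\<And>u. 0 \<le> u \<Longrightarrow> N u \<in> measurable M (count_space UNIV)"
    and rc: "\<And>\<omega> u. \<omega> \<in> space M \<Longrightarrow> 0 \<le> u \<Longrightarrow> continuous (at_right u) (\<lambda>s. N s \<omega>)"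
  shows "(\<lambda>(\<omega>, u). vel (d + N (max 0 u) \<omega>)) \<in> borel_measurable (M \<Otimes>\<^sub>M lborel)"
proof (rule borel_measurable_LIMSEQ_real)
  define grid where "grid k u = real_of_int \<lceil>max 0 u * real (Suc k)\<rceil> / real (Suc k)" for k and u :: real
  have grid_ge: "max 0 u \<le> grid k u" for k u
    unfolding grid_def
    by (simp only: pos_le_divide_eq of_nat_0_less_iff zero_less_Suc le_of_int_ceiling)
  have grid_le: "grid k u \<le> max 0 u + 1 / real (Suc k)" for k u
    unfolding grid_def
    by (simp add: pos_divide_le_eq distrib_right del: of_nat_Suc)
  have grid_lim: "(\<lambda>k. grid k u) \<longlonglongrightarrow> max 0 u" for u
  proof (rule tendsto_sandwich[where f="\<lambda>_. max 0 u"])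
    show "(\<lambda>k. max 0 u + 1 / real (Suc k)) \<longlonglongrightarrow> max 0 u"
      using tendsto_add[OF tendsto_const LIMSEQ_inverse_real_of_nat, of "max 0 u"]
      by (simp add: divide_inverse)
  qed (use grid_ge grid_le in auto)
  show "(\<lambda>(\<omega>, u). vel (d + N (grid k u) \<omega>)) \<in> borel_measurable (M \<Otimes>\<^sub>M lborel)" for k
  proof -
    have "(\<lambda>x. vel (d + N (max 0 (real_of_int i / real (Suc k))) (fst x)))
        \<in> borel_measurable (M \<Otimes>\<^sub>M lborel)" for i
    proof -
      have [measurable]: "N (max 0 (real_of_int i / real (Suc k))) \<in> measurable M (count_space UNIV)"
        by (rule meas) simp
      show ?thesis by measurable
    qed
    moreover have "(\<lambda>x. \<lceil>max 0 (snd x) * real (Suc k)\<rceil>) \<in> measurable (M \<Otimes>\<^sub>M (lborel :: real measure)) (count_space UNIV)"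
      by measurable
    ultimately have "(\<lambda>x. vel (d + N (max 0 (grid k (snd x))) (fst x)))
        \<in> borel_measurable (M \<Otimes>\<^sub>M lborel)"
      unfolding grid_def by (rule measurable_compose_countable)
    moreover have "max 0 (grid k u) = grid k u" for u
      using grid_ge[of u k] by simp
    ultimately show ?thesis
      by (simp add: case_prod_beta)
  qed
  fix x assume "x \<in> space (M \<Otimes>\<^sub>M (lborel :: real measure))"
  then obtain \<omega> u where x: "x = (\<omega>, u)" "\<omega> \<in> space M"
    by (auto simp: space_pair_measure)
  have "((\<lambda>s. N s \<omega>) \<longlongrightarrow> N (max 0 u) \<omega>) (at_right (max 0 u))"
    using rc[OF x(2), of "max 0 u"] by (simp add: continuous_within)
  then have "eventually (\<lambda>s. N s \<omega> = N (max 0 u) \<omega>) (at_right (max 0 u))"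
    by (simp add: tendsto_discrete)
  then obtain b where b: "b > max 0 u" "\<And>s. max 0 u < s \<Longrightarrow> s < b \<Longrightarrow> N s \<omega> = N (max 0 u) \<omega>"
    by (auto simp: eventually_at_right[of "max 0 u" "max 0 u + 1"])
  have "eventually (\<lambda>k. grid k u < b) sequentially"
    using grid_lim[of u] b(1) by (rule order_tendstoD)
  then have "eventually (\<lambda>k. vel (d + N (grid k u) \<omega>) = vel (d + N (max 0 u) \<omega>)) sequentially"
  proof eventually_elim
    case (elim k)
    then show ?case
      using b(2)[OF _ elim] grid_ge[of u k] by (metis order_le_less)
  qed
  then show "(\<lambda>k. case x of (\<omega>, u) \<Rightarrow> vel (d + N (grid k u) \<omega>))
      \<longlonglongrightarrow> (case x of (\<omega>, u) \<Rightarrow> vel (d + N (max 0 u) \<omega>))"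
    by (simp add: x(1) tendsto_eventually)
qed

lemma disp_measurable:
  fixes N :: "real \<Rightarrow> 'a \<Rightarrow> nat"
  assumes meas: "\<And>u. 0 \<le> u \<Longrightarrow> N u \<in> measurable M (count_space UNIV)"
    and mono: "\<And>\<omega>. \<omega> \<in> space M \<Longrightarrow> mono_on {0..} (\<lambda>u. N u \<omega>)"
    and rc: "\<And>\<omega> u. \<omega> \<in> space M \<Longrightarrow> 0 \<le> u \<Longrightarrow> continuous (at_right u) (\<lambda>s. N s \<omega>)"
    and "0 \<le> s"
  shows "(\<lambda>\<omega>. disp d (\<lambda>u. N u \<omega>) s) \<in> borel_measurable M"
proof -
  have [measurable]: "(\<lambda>x. vel (d + N (max 0 (snd x)) (fst x))) \<in> borel_measurable (M \<Otimes>\<^sub>M lborel)"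
    using vel_jointly_measurable[of N M d, OF meas rc] by (simp add: split_beta')
  have "(\<lambda>\<omega>. LINT u:{0..s}|lborel. vel (d + N (max 0 u) \<omega>)) \<in> borel_measurable M"
    unfolding set_lebesgue_integral_def
    by (rule lborel.borel_measurable_lebesgue_integral) (simp add: split_beta')
  then show ?thesis
    by (subst measurable_cong[OF disp_eq_lebesgue_integral]) (use mono \<open>0 \<le> s\<close> in auto)
qed

lemma stays_below_iff_rational:
  assumes m: "mono_on {0..} m"
  shows "stays_below d m t \<beta> \<longleftrightarrow> (\<forall>s\<in>\<rat> \<inter> {0..t}. disp d m s \<le> \<beta>)"
proof
  assume R: "\<forall>s\<in>\<rat> \<inter> {0..t}. disp d m s \<le> \<beta>"
  show "stays_below d m t \<beta>"
    unfolding stays_below_def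
  proof
    fix s assume s: "s \<in> {0..t}"
    define q where "q k = real_of_int \<lfloor>s * real (Suc k)\<rfloor> / real (Suc k)" for k
    have q_le: "q k \<le> s" for k
      unfolding q_def by (simp add: pos_divide_le_eq del: of_nat_Suc)
    have q_ge: "s - 1 / real (Suc k) \<le> q k" for k
      unfolding q_def by (simp add: pos_le_divide_eq left_diff_distrib del: of_nat_Suc)
    have q_nonneg: "0 \<le> q k" for k
      unfolding q_def using s by simp
    have "q \<longlonglongrightarrow> s"
    proof (rule tendsto_sandwich)
      show "(\<lambda>k. s - 1 / real (Suc k)) \<longlonglongrightarrow> s"
        using tendsto_diff[OF tendsto_const LIMSEQ_inverse_real_of_nat, of s]
        by (simp add: divide_inverse)
    qed (use q_ge q_le in auto)
    moreover have "q k \<in> {0..t}" for k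
      using q_le[of k] q_nonneg[of k] s by auto
    ultimately have "(\<lambda>k. disp d m (q k)) \<longlonglongrightarrow> disp d m s"
      by (intro continuous_on_tendsto_compose[OF disp_continuous[OF m, of t] _ s]) auto
    moreover have "disp d m (q k) \<le> \<beta>" for k
      using R \<open>\<And>k. q k \<in> {0..t}\<close> by (auto simp: q_def)
    ultimately show "disp d m s \<le> \<beta>"
      by (auto intro: LIMSEQ_le_const2)
  qed
qed (auto simp: stays_below_def)

text \<open>
  The \<sigma>-algebra is arbitrary here. The lemma is applied to the one generated by the process, which
  is needed to exploit independence, and to the given one.
\<close>
lemma stays_below_measurable:
  fixes N :: "real \<Rightarrow> 'a \<Rightarrow> nat"
  assumes meas: "\<And>u. 0 \<le> u \<Longrightarrow> N u \<in> measurable M (count_space UNIV)"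
    and mono: "\<And>\<omega>. \<omega> \<in> space M \<Longrightarrow> mono_on {0..} (\<lambda>u. N u \<omega>)"
    and rc: "\<And>\<omega> u. \<omega> \<in> space M \<Longrightarrow> 0 \<le> u \<Longrightarrow> continuous (at_right u) (\<lambda>s. N s \<omega>)"
  shows "{\<omega> \<in> space M. stays_below d (\<lambda>u. N u \<omega>) t \<beta>} \<in> sets M"
proof -
  have "{\<omega> \<in> space M. \<forall>s\<in>\<rat> \<inter> {0..t}. disp d (\<lambda>u. N u \<omega>) s \<le> \<beta>} \<in> sets M"
  proof (rule sets.sets_Collect_countable_All')
    show "countable (\<rat> \<inter> {0..t})"
      using countable_rat by blast
    show "{\<omega> \<in> space M. disp d (\<lambda>u. N u \<omega>) s \<le> \<beta>} \<in> sets M" if "s \<in> \<rat> \<inter> {0..t}" for s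
    proof -
      have [measurable]: "(\<lambda>\<omega>. disp d (\<lambda>u. N u \<omega>) s) \<in> borel_measurable M"
        using that by (intro disp_measurable meas mono rc) auto
      show ?thesis by measurable
    qed
  qed
  then show ?thesis
    by (rule back_subst[where P="\<lambda>A. A \<in> sets M"]) (use mono stays_below_iff_rational in auto)
qed

end

section \<open>Restarted Poisson processes\<close>

lemma continuous_at_right_discrete_iff:
  fixes f :: "real \<Rightarrow> 'b :: discrete_topology"
  shows "continuous (at_right u) f \<longleftrightarrow> (\<exists>b>u. \<forall>y. u < y \<and> y < b \<longrightarrow> f y = f u)"
  by (simp add: continuous_within tendsto_discrete eventually_at_right[of u "u + 1"] imp_conjL)

lemma poisson_process_prob_space: "poisson_process M rate N \<Longrightarrow> prob_space M"
  by (simp add: poisson_process_def)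

lemma poisson_process_measurable:
  "poisson_process M rate N \<Longrightarrow> 0 \<le> u \<Longrightarrow> N u \<in> measurable M (count_space UNIV)"
  by (simp add: poisson_process_def)

lemma poisson_process_mono:
  "poisson_process M rate N \<Longrightarrow> \<omega> \<in> space M \<Longrightarrow> mono_on {0..} (\<lambda>u. N u \<omega>)"
  by (simp add: poisson_process_def)

lemma poisson_process_le:
  "poisson_process M rate N \<Longrightarrow> \<omega> \<in> space M \<Longrightarrow> 0 \<le> s \<Longrightarrow> s \<le> u \<Longrightarrow> N s \<omega> \<le> N u \<omega>"
  by (drule (1) poisson_process_mono) (auto simp: mono_on_def)

lemma poisson_process_zero:
  "poisson_process M rate N \<Longrightarrow> \<omega> \<in> space M \<Longrightarrow> N 0 \<omega> = 0"
  by (simp add: poisson_process_def)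

lemma poisson_process_right_continuous:
  "poisson_process M rate N \<Longrightarrow> \<omega> \<in> space M \<Longrightarrow> 0 \<le> u \<Longrightarrow>
    continuous (at_right u) (\<lambda>s. N s \<omega>)"
  by (simp add: poisson_process_def)

lemma poisson_process_indep_increments:
  assumes "poisson_process M rate N" "0 \<le> \<tau> 0" "mono_on {..n::nat} \<tau>"
  shows "prob_space.indep_vars M (\<lambda>_. count_space UNIV)
    (\<lambda>i \<omega>. N (\<tau> (Suc i)) \<omega> - N (\<tau> i) \<omega>) {..<n}"
proof -
  have "\<forall>(\<tau> :: nat \<Rightarrow> real) n. 0 \<le> \<tau> 0 \<and> mono_on {..n} \<tau> \<longrightarrow>
        prob_space.indep_vars M (\<lambda>_. count_space UNIV)
          (\<lambda>i \<omega>. N (\<tau> (Suc i)) \<omega> - N (\<tau> i) \<omega>) {..<n}"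
    using assms(1) unfolding poisson_process_def by (elim conjE) assumption
  from this[rule_format, of \<tau> n] show ?thesis using assms(2,3) by simp
qed

lemma poisson_process_distr_increment:
  assumes "poisson_process M rate N" "0 \<le> s" "s < t"
  shows "distr M (count_space UNIV) (\<lambda>\<omega>. N t \<omega> - N s \<omega>)
    = measure_pmf (poisson_pmf (rate * (t - s)))"
  using assms unfolding poisson_process_def by (elim conjE) simp

lemma poisson_process_prob:
  assumes N: "poisson_process M rate N" and "0 \<le> t"
  shows "measure M {\<omega> \<in> space M. N t \<omega> = n} = exp (- (rate * t)) * (rate * t) ^ n / fact n"
proof (cases "t = 0")
  case True
  interpret prob_space M using N by (rule poisson_process_prob_space)
  have "{\<omega> \<in> space M. N t \<omega> = n} = (if n = 0 then space M else {})"
    using poisson_process_zero[OF N] True by auto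
  then show ?thesis using True by (simp add: prob_space power_0_left)
next
  case False
  then have t: "0 < t" using \<open>0 \<le> t\<close> by simp
  have meas: "N t \<in> measurable M (count_space UNIV)"
    using poisson_process_measurable[OF N \<open>0 \<le> t\<close>] .
  have "distr M (count_space UNIV) (\<lambda>\<omega>. N t \<omega> - N 0 \<omega>) = measure_pmf (poisson_pmf (rate * (t - 0)))"
    using poisson_process_distr_increment[OF N _ t] by simp
  also have "distr M (count_space UNIV) (\<lambda>\<omega>. N t \<omega> - N 0 \<omega>) = distr M (count_space UNIV) (N t)"
    by (rule distr_cong) (use poisson_process_zero[OF N] in auto)
  finally have d: "distr M (count_space UNIV) (N t) = measure_pmf (poisson_pmf (rate * t))"
    by simp
  have "measure M {\<omega> \<in> space M. N t \<omega> = n} = measure (distr M (count_space UNIV) (N t)) {n}"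
    by (subst measure_distr[OF meas]) (auto intro!: arg_cong[where f="measure M"])
  also have "\<dots> = pmf (poisson_pmf (rate * t)) n"
    by (simp add: d measure_pmf_single)
  also have "\<dots> = exp (- (rate * t)) * (rate * t) ^ n / fact n"
    using N t by (subst pmf_poisson) (auto simp: poisson_process_def)
  finally show ?thesis .
qed

text \<open>For paths of a counting process the truncated subtraction is the true difference.\<close>
definition restart :: "real \<Rightarrow> (real \<Rightarrow> 'a \<Rightarrow> nat) \<Rightarrow> real \<Rightarrow> 'a \<Rightarrow> nat" where
  "restart h N u \<omega> = N (h + u) \<omega> - N h \<omega>"

lemma poisson_process_restart:
  assumes N: "poisson_process M rate N" and h: "0 \<le> h"
  shows "poisson_process M rate (restart h N)"
  unfolding poisson_process_def
proof (intro conjI allI ballI impI)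
  show "prob_space M" "rate > 0" using N by (auto simp: poisson_process_def)
  interpret prob_space M by fact
  show meas: "restart h N u \<in> measurable M (count_space UNIV)" if "0 \<le> u" for u
  proof -
    have "(\<lambda>\<omega>. N (h + u) \<omega> - i) \<in> measurable M (count_space UNIV)" for i
      by (rule measurable_compose[OF poisson_process_measurable[OF N]]) (use h that in auto)
    then show ?thesis unfolding restart_def[abs_def]
      by (rule measurable_compose_countable) (rule poisson_process_measurable[OF N h])
  qed
  fix \<omega> assume \<omega>: "\<omega> \<in> space M"
  show "restart h N 0 \<omega> = 0" by (simp add: restart_def)
  show "mono_on {0..} (\<lambda>u. restart h N u \<omega>)"
    using poisson_process_mono[OF N \<omega>] h by (auto simp: mono_on_def restart_def intro!: diff_le_mono)
  show "continuous (at_right u) (\<lambda>s. restart h N s \<omega>)" if u: "0 \<le> u" for u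
  proof -
    from poisson_process_right_continuous[OF N \<omega>, of "h + u"] h u
    obtain b where "b > h + u" "\<And>y. h + u < y \<Longrightarrow> y < b \<Longrightarrow> N y \<omega> = N (h + u) \<omega>"
      by (auto simp: continuous_at_right_discrete_iff)
    then show ?thesis
      unfolding continuous_at_right_discrete_iff restart_def
      by (intro exI[of _ "b - h"]) auto
  qed
next
  interpret prob_space M by (rule poisson_process_prob_space[OF N])
  fix \<tau> :: "nat \<Rightarrow> real" and n
  assume \<tau>: "0 \<le> \<tau> 0 \<and> mono_on {..n} \<tau>"
  let ?X = "\<lambda>i \<omega>. N (h + \<tau> (Suc i)) \<omega> - N (h + \<tau> i) \<omega>"
  let ?Y = "\<lambda>i \<omega>. restart h N (\<tau> (Suc i)) \<omega> - restart h N (\<tau> i) \<omega>"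
  have X: "indep_vars (\<lambda>_. count_space UNIV) ?X {..<n}"
    by (rule poisson_process_indep_increments[OF N, where \<tau>="\<lambda>i. h + \<tau> i"])
       (use \<tau> h in \<open>auto simp: mono_on_def\<close>)
  have eq: "?X i \<omega> = ?Y i \<omega>" if "i < n" "\<omega> \<in> space M" for i \<omega>
  proof -
    have "0 \<le> \<tau> i"
      using \<tau> that(1) by (auto simp: mono_on_def intro: order_trans[of _ "\<tau> 0"])
    then have "N h \<omega> \<le> N (h + \<tau> i) \<omega>"
      using h that by (intro poisson_process_le[OF N]) auto
    then show ?thesis by (simp add: restart_def)
  qed
  have vim: "?X i -` A \<inter> space M = ?Y i -` A \<inter> space M" if "i < n" for i A
    using eq[OF that] by auto
  have "indep_sets (\<lambda>i. {?X i -` A \<inter> space M |A. A \<in> sets (count_space UNIV)}) {..<n}"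
    using X by (simp only: indep_vars_def2)
  then have "indep_sets (\<lambda>i. {?Y i -` A \<inter> space M |A. A \<in> sets (count_space UNIV)}) {..<n}"
    by (rule iffD1[OF indep_sets_cong, rotated -1]) (simp_all only: vim lessThan_iff)
  moreover have "random_variable (count_space UNIV) (?Y i)"
    if "i < n" "random_variable (count_space UNIV) (?X i)" for i
    using that(2) eq[OF that(1)] by (simp cong: measurable_cong)
  ultimately show "indep_vars (\<lambda>_. count_space UNIV) ?Y {..<n}"
    using X by (simp only: indep_vars_def2 lessThan_iff) blast
next
  fix s t :: real assume st: "0 \<le> s \<and> s < t"
  have "distr M (count_space UNIV) (\<lambda>\<omega>. restart h N t \<omega> - restart h N s \<omega>)
      = distr M (count_space UNIV) (\<lambda>\<omega>. N (h + t) \<omega> - N (h + s) \<omega>)"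
  proof (rule distr_cong)
    fix \<omega> assume "\<omega> \<in> space M"
    then have "N h \<omega> \<le> N (h + s) \<omega>"
      using h st by (intro poisson_process_le[OF N]) auto
    then show "restart h N t \<omega> - restart h N s \<omega> = N (h + t) \<omega> - N (h + s) \<omega>"
      by (simp add: restart_def)
  qed auto
  also have "\<dots> = measure_pmf (poisson_pmf (rate * ((h + t) - (h + s))))"
    by (rule poisson_process_distr_increment[OF N]) (use h st in auto)
  finally show "distr M (count_space UNIV) (\<lambda>\<omega>. restart h N t \<omega> - restart h N s \<omega>)
      = measure_pmf (poisson_pmf (rate * (t - s)))" by simp
qed

lemma restart_restart:
  assumes N: "poisson_process M rate N" and "0 \<le> h" "0 \<le> h'" "0 \<le> u" "\<omega> \<in> space M"
  shows "restart h' (restart h N) u \<omega> = restart (h + h') N u \<omega>"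
proof -
  have "N h \<omega> \<le> N (h + h') \<omega>"
    by (rule poisson_process_le[OF N]) (use assms in auto)
  then show ?thesis by (simp add: restart_def add.assoc)
qed

text \<open>
  Representing the constraints as pairs, possibly contradictory ones, makes the intersection of two
  cylinders the cylinder of the union, so that cylinders are closed under intersection.
\<close>
definition cylinder :: "'a measure \<Rightarrow> (real \<Rightarrow> 'a \<Rightarrow> nat) \<Rightarrow> (real \<times> nat) set \<Rightarrow> 'a set" where
  "cylinder M X R = {\<omega> \<in> space M. \<forall>p\<in>R. X (fst p) \<omega> = snd p}"

text \<open>
  Pick any \<open>\<omega>0\<close> in the cylinder. Belonging to the cylinder then means agreeing with \<open>\<omega>0\<close> at
  finitely many times, which is the same as having the same increments as \<open>\<omega>0\<close> between
  consecutive times; these increments and \<open>N h\<close> are independent.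
\<close>
lemma cylinder_indep_count:
  assumes N: "poisson_process M rate N" and h: "0 \<le> h" and R: "finite R" "fst ` R \<subseteq> {0..}"
  shows "measure M ({\<omega> \<in> space M. N h \<omega> = j} \<inter> cylinder M (restart h N) R)
    = measure M {\<omega> \<in> space M. N h \<omega> = j} * measure M (cylinder M (restart h N) R)"
proof (cases "cylinder M (restart h N) R = {}")
  case False
  interpret prob_space M using N by (rule poisson_process_prob_space)
  obtain \<omega>0 where \<omega>0: "\<omega>0 \<in> cylinder M (restart h N) R" using False by blast
  then have \<omega>0_space: "\<omega>0 \<in> space M" by (simp add: cylinder_def)
  define xs where "xs = sorted_list_of_set (fst ` R)"
  define m where "m = length xs"
  have set_xs: "set xs = fst ` R" and sorted_xs: "sorted xs"
    using R by (simp_all add: xs_def)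
  have xs_nonneg: "0 \<le> x" if "x \<in> set xs" for x
    using that R(2) by (auto simp: set_xs)
  \<comment> \<open>The partition \<open>0, h, h + x1, h + x2, \<dots>\<close>: increment \<open>0\<close> is \<open>N h\<close>, all others belong to the
    restarted process.\<close>
  define \<sigma> where "\<sigma> i = (0 # xs) ! i" for i
  define \<tau> where "\<tau> i = (case i of 0 \<Rightarrow> 0 | Suc i' \<Rightarrow> h + \<sigma> i')" for i
  have sorted_0xs: "sorted (0 # xs)" using sorted_xs xs_nonneg by simp
  have \<sigma>_mono: "\<sigma> i \<le> \<sigma> i'" if "i \<le> i'" "i' \<le> m" for i i'
    unfolding \<sigma>_def by (rule sorted_nth_mono[OF sorted_0xs that(1)]) (use that(2) in \<open>simp add: m_def\<close>)
  have \<sigma>_nonneg: "0 \<le> \<sigma> i" if "i \<le> m" for i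
    using \<sigma>_mono[of 0 i] that by (simp add: \<sigma>_def)
  have "mono_on {..Suc m} \<tau>"
    using \<sigma>_mono \<sigma>_nonneg h by (auto simp: mono_on_def \<tau>_def split: nat.split)
  define X where "X i \<omega> = N (\<tau> (Suc i)) \<omega> - N (\<tau> i) \<omega>" for i \<omega>
  have ind: "indep_vars (\<lambda>_. count_space UNIV) X {..<Suc m}"
    unfolding X_def[abs_def]
    by (rule poisson_process_indep_increments[OF N _ \<open>mono_on {..Suc m} \<tau>\<close>]) (simp add: \<tau>_def)
  have X0: "X 0 \<omega> = N h \<omega>" if "\<omega> \<in> space M" for \<omega>
    using poisson_process_zero[OF N that] by (simp add: X_def \<tau>_def \<sigma>_def)
  have step: "restart h N (\<sigma> (Suc i)) \<omega> = restart h N (\<sigma> i) \<omega> + X (Suc i) \<omega>"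
    if "\<omega> \<in> space M" "i < m" for i \<omega>
  proof -
    have "N h \<omega> \<le> N (h + \<sigma> i) \<omega>" "N (h + \<sigma> i) \<omega> \<le> N (h + \<sigma> (Suc i)) \<omega>"
      using that \<sigma>_mono[of i "Suc i"] \<sigma>_nonneg[of i] h by (auto intro!: poisson_process_le[OF N])
    then show ?thesis by (simp add: restart_def X_def \<tau>_def)
  qed
  define B where "B i = (if i = 0 then {j} else {X i \<omega>0})" for i
  have cyl: "\<omega> \<in> cylinder M (restart h N) R \<longleftrightarrow> (\<forall>i\<in>{1..m}. X i \<omega> = X i \<omega>0)"
    if \<omega>: "\<omega> \<in> space M" for \<omega>
  proof -
    have "\<omega> \<in> cylinder M (restart h N) R \<longleftrightarrow>
        (\<forall>u\<in>fst ` R. restart h N u \<omega> = restart h N u \<omega>0)"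
      using \<omega>0 \<omega> by (force simp: cylinder_def)
    also have "\<dots> \<longleftrightarrow> (\<forall>i\<le>m. restart h N (\<sigma> i) \<omega> = restart h N (\<sigma> i) \<omega>0)"
    proof -
      have "(\<forall>u\<in>fst ` R. restart h N u \<omega> = restart h N u \<omega>0) \<longleftrightarrow>
          (\<forall>u\<in>set (0 # xs). restart h N u \<omega> = restart h N u \<omega>0)"
        by (simp add: set_xs restart_def)
      also have "\<dots> \<longleftrightarrow> (\<forall>i<length (0 # xs). restart h N ((0 # xs) ! i) \<omega> = restart h N ((0 # xs) ! i) \<omega>0)"
        by (rule all_set_conv_all_nth)
      finally show ?thesis by (simp add: \<sigma>_def m_def less_Suc_eq_le)
    qed
    also have "\<dots> \<longleftrightarrow> (\<forall>i\<in>{1..m}. X i \<omega> = X i \<omega>0)"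
    proof
      assume L: "\<forall>i\<le>m. restart h N (\<sigma> i) \<omega> = restart h N (\<sigma> i) \<omega>0"
      show "\<forall>i\<in>{1..m}. X i \<omega> = X i \<omega>0"
      proof
        fix i assume "i \<in> {1..m}"
        then obtain i' where "i = Suc i'" "i' < m" by (cases i) auto
        then show "X i \<omega> = X i \<omega>0"
          using step[OF \<omega>, of i'] step[OF \<omega>0_space, of i'] L by auto
      qed
    next
      assume Rr: "\<forall>i\<in>{1..m}. X i \<omega> = X i \<omega>0"
      have "restart h N (\<sigma> i) \<omega> = restart h N (\<sigma> i) \<omega>0" if "i \<le> m" for i
        using that
      proof (induction i)
        case 0
        then show ?case by (simp add: \<sigma>_def restart_def)
      next
        case (Suc i)
        then show ?case using step[OF \<omega>, of i] step[OF \<omega>0_space, of i] Rr by auto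
      qed
      then show "\<forall>i\<le>m. restart h N (\<sigma> i) \<omega> = restart h N (\<sigma> i) \<omega>0" by blast
    qed
    finally show ?thesis .
  qed
  show ?thesis
  proof (cases "m = 0")
    case True
    have "\<omega> \<in> cylinder M (restart h N) R" if "\<omega> \<in> space M" for \<omega>
      using cyl[OF that] True by simp
    moreover have "cylinder M (restart h N) R \<subseteq> space M"
      by (auto simp: cylinder_def)
    ultimately have "cylinder M (restart h N) R = space M"
      by blast
    then show ?thesis by (simp add: prob_space Int_absorb2 subset_iff)
  next
    case False
    have N0: "{\<omega> \<in> space M. N h \<omega> = j} = X 0 -` B 0 \<inter> space M"
      using X0 by (auto simp: B_def)
    have C: "cylinder M (restart h N) R = (\<Inter>i\<in>{1..m}. X i -` B i \<inter> space M)"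
      using False cyl by (auto simp: B_def cylinder_def)
    have "prob (\<Inter>i\<in>insert 0 {1..m}. X i -` B i \<inter> space M)
        = (\<Prod>i\<in>insert 0 {1..m}. prob (X i -` B i \<inter> space M))"
      by (rule indep_varsD[OF ind]) auto
    moreover have "prob (\<Inter>i\<in>{1..m}. X i -` B i \<inter> space M)
        = (\<Prod>i\<in>{1..m}. prob (X i -` B i \<inter> space M))"
      by (rule indep_varsD[OF ind]) (use False in auto)
    ultimately show ?thesis
      unfolding N0 C by simp
  qed
qed simp

context telegraph_speeds begin

lemma stay_event_measurable:
  assumes N: "poisson_process M rate N"
    and M': "space M' = space M" "\<And>u. 0 \<le> u \<Longrightarrow> N u \<in> measurable M' (count_space UNIV)"
    and "0 \<le> t"
  shows "{\<omega> \<in> space M. N t \<omega> = n \<and> stays_below d (\<lambda>u. N u \<omega>) t \<beta>} \<in> sets M'"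
proof -
  have "{\<omega> \<in> space M'. stays_below d (\<lambda>u. N u \<omega>) t \<beta>} \<in> sets M'"
    by (rule stays_below_measurable)
       (use M' poisson_process_mono[OF N] poisson_process_right_continuous[OF N] in auto)
  moreover have "N t -` {n} \<inter> space M' \<in> sets M'"
    by (rule measurable_sets[OF M'(2)[OF \<open>0 \<le> t\<close>]]) simp
  ultimately have "{\<omega> \<in> space M'. stays_below d (\<lambda>u. N u \<omega>) t \<beta>} \<inter> (N t -` {n} \<inter> space M') \<in> sets M'"
    by (rule sets.Int)
  then show ?thesis
    by (rule back_subst[where P="\<lambda>A. A \<in> sets M'"]) (auto simp: M')
qed

definition stay_prob :: "'a measure \<Rightarrow> (real \<Rightarrow> 'a \<Rightarrow> nat) \<Rightarrow> nat \<Rightarrow> nat \<Rightarrow> real \<Rightarrow> real \<Rightarrow> real" where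
  "stay_prob M N d n t \<beta> =
     measure M {\<omega> \<in> space M. N t \<omega> = n \<and> stays_below d (\<lambda>u. N u \<omega>) t \<beta>}"

text \<open>
  Independence of \<open>N h\<close> and the restarted process passes from cylinders to the \<sigma>-algebra that they
  generate, and this contains the event of staying below a level.
\<close>
lemma stay_prob_after_restart:
  assumes N: "poisson_process M rate N" and h: "0 \<le> h" and t: "0 \<le> t"
  shows "measure M {\<omega> \<in> space M. N h \<omega> = j \<and> restart h N t \<omega> = n \<and>
        stays_below d (\<lambda>u. restart h N u \<omega>) t \<beta>}
    = exp (- (rate * h)) * (rate * h) ^ j / fact j * stay_prob M (restart h N) d n t \<beta>"
proof -
  interpret prob_space M using N by (rule poisson_process_prob_space)
  note rN = poisson_process_restart[OF N h]
  define Cyl where "Cyl = {cylinder M (restart h N) R | R. finite R \<and> fst ` R \<subseteq> {0..}}"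
  let ?A = "{\<omega> \<in> space M. N h \<omega> = j}"
  let ?E = "{\<omega> \<in> space M. restart h N t \<omega> = n \<and> stays_below d (\<lambda>u. restart h N u \<omega>) t \<beta>}"
  have A: "?A \<in> events"
    using measurable_sets[OF poisson_process_measurable[OF N h], of "{j}"]
    by (simp add: vimage_def Int_def conj_commute)
  have Cyl_single: "{\<omega> \<in> space M. restart h N u \<omega> = n} \<in> Cyl" if "0 \<le> u" for u n
    unfolding Cyl_def using that by (auto intro!: exI[of _ "{(u, n)}"] simp: cylinder_def)
  have Cyl_events: "Cyl \<subseteq> events"
  proof
    fix C assume "C \<in> Cyl"
    then obtain R where R: "C = cylinder M (restart h N) R" "finite R" "fst ` R \<subseteq> {0..}"
      by (auto simp: Cyl_def)
    have "{\<omega> \<in> space M. restart h N (fst p) \<omega> = snd p} \<in> events" if "p \<in> R" for p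
      using measurable_sets[OF poisson_process_measurable[OF rN], of "fst p" "{snd p}"] that R(3)
      by (force simp: vimage_def Int_def conj_commute)
    then have "{\<omega> \<in> space M. \<forall>p\<in>R. restart h N (fst p) \<omega> = snd p} \<in> events"
      by (rule sets.sets_Collect_countable_All') (auto intro: countable_finite[OF R(2)])
    then show "C \<in> events" by (simp add: R(1) cylinder_def)
  qed
  have "indep_set {?A} Cyl"
    using A Cyl_events cylinder_indep_count[OF N h] by (intro indep_setI) (auto simp: Cyl_def)
  moreover have "Int_stable Cyl"
  proof (rule Int_stableI)
    fix C D assume "C \<in> Cyl" "D \<in> Cyl"
    then obtain R S where "C = cylinder M (restart h N) R" "finite R" "fst ` R \<subseteq> {0..}"
      "D = cylinder M (restart h N) S" "finite S" "fst ` S \<subseteq> {0..}" by (auto simp: Cyl_def)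
    moreover from this have "C \<inter> D = cylinder M (restart h N) (R \<union> S)"
      by (auto simp: cylinder_def)
    ultimately show "C \<inter> D \<in> Cyl"
      unfolding Cyl_def by (auto intro!: exI[of _ "R \<union> S"])
  qed
  moreover have "Int_stable {?A}" by (simp add: Int_stable_def)
  ultimately have ind: "indep_set (sigma_sets (space M) {?A}) (sigma_sets (space M) Cyl)"
    by (intro indep_set_sigma_sets)
  have Cyl_Pow: "Cyl \<subseteq> Pow (space M)"
    using Cyl_events sets.space_closed by blast
  have "?E \<in> sets (sigma (space M) Cyl)"
  proof (rule stay_event_measurable[OF rN _ _ t])
    show "restart h N u \<in> measurable (sigma (space M) Cyl) (count_space UNIV)" if "0 \<le> u" for u
      using Cyl_single[OF that] Cyl_Pow
      by (subst measurable_count_space_eq2_countable)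
         (auto simp: vimage_def Int_def conj_commute intro: sigma_sets.Basic)
  qed (simp add: Cyl_Pow)
  then have "?E \<in> sigma_sets (space M) Cyl"
    using Cyl_Pow by simp
  then have "prob (?A \<inter> ?E) = prob ?A * prob ?E"
    by (intro indep_setD[OF ind]) auto
  moreover have "?A \<inter> ?E = {\<omega> \<in> space M. N h \<omega> = j \<and> restart h N t \<omega> = n \<and>
        stays_below d (\<lambda>u. restart h N u \<omega>) t \<beta>}" by auto
  ultimately show ?thesis
    by (simp add: stay_prob_def poisson_process_prob[OF N h])
qed

end

section \<open>The polynomials and the limit argument\<close>

text \<open>
  Walking from \<open>0\<close> to \<open>x\<close> in \<open>m\<close> equal steps costs at most \<open>\<epsilon> * x\<close> in total. Since
  \<open>D\<close> need not be continuous, this replaces an argument with derivatives.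
\<close>
lemma telescoping_nonpos:
  fixes D :: "real \<Rightarrow> real"
  assumes "0 \<le> x" "D x \<le> 0"
    and step: "\<And>\<epsilon>. 0 < \<epsilon> \<Longrightarrow>
      \<exists>\<delta>>0. \<forall>s h. 0 \<le> s \<and> 0 < h \<and> h < \<delta> \<and> s + h \<le> x \<longrightarrow> D s \<le> D (s + h) + \<epsilon> * h"
  shows "D 0 \<le> 0"
proof (cases "x = 0")
  case False
  with \<open>0 \<le> x\<close> have x: "0 < x" by simp
  show ?thesis
  proof (rule field_le_epsilon)
    fix e :: real assume "0 < e"
    then obtain \<delta> where \<delta>: "\<delta> > 0"
      "\<And>s h. 0 \<le> s \<Longrightarrow> 0 < h \<Longrightarrow> h < \<delta> \<Longrightarrow> s + h \<le> x \<Longrightarrow> D s \<le> D (s + h) + e / x * h"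
      using step[of "e / x"] x by auto
    obtain m :: nat where "x / \<delta> < real m" using reals_Archimedean2 by blast
    then have m: "x < real m * \<delta>" "0 < m"
      using \<open>\<delta> > 0\<close> x by (auto simp: field_simps intro!: gr0I)
    define h where "h = x / real m"
    have h: "0 < h" "h < \<delta>" "real m * h = x" using m x by (auto simp: h_def field_simps)
    have "D 0 \<le> D (real i * h) + e / x * (real i * h)" if "i \<le> m" for i
      using that
    proof (induction i)
      case (Suc i)
      have "real i * h + h = real (Suc i) * h" by (simp add: algebra_simps)
      moreover have "real (Suc i) * h \<le> real m * h"
        using Suc.prems h(1) by (intro mult_right_mono) auto
      ultimately have "D (real i * h) \<le> D (real (Suc i) * h) + e / x * h"
        using \<delta>(2)[of "real i * h" h] h by simp
      then show ?case using Suc by (simp add: algebra_simps)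
    qed simp
    from this[of m] show "D 0 \<le> 0 + e"
      using h x \<open>D x \<le> 0\<close> by simp
  qed
qed (use assms in simp)

text \<open>
  The first \<open>m\<close> terms of the binomial expansion of \<open>(a + b) ^ n\<close>. Differentiating in \<open>a\<close> lowers
  both \<open>n\<close> and \<open>m\<close>, differentiating in \<open>b\<close> lowers only \<open>n\<close>.
\<close>
definition binomial_head :: "nat \<Rightarrow> nat \<Rightarrow> real \<Rightarrow> real \<Rightarrow> real" where
  "binomial_head n m a b = (\<Sum>j<m. real (n choose j) * (a ^ j * b ^ (n - j)))"

lemma binomial_head_deriv_fst:
  "((\<lambda>a. binomial_head (Suc n) (Suc m) a b) has_real_derivative
     real (Suc n) * binomial_head n m a b) (at a)"
proof -
  have "((\<lambda>a. binomial_head (Suc n) (Suc m) a b) has_real_derivative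
     (\<Sum>j<Suc m. real (Suc n choose j) * (real j * a ^ (j - 1) * b ^ (Suc n - j)))) (at a)"
    unfolding binomial_head_def by (auto intro!: derivative_eq_intros sum.cong)
  also have "(\<Sum>j<Suc m. real (Suc n choose j) * (real j * a ^ (j - 1) * b ^ (Suc n - j)))
      = (\<Sum>j<m. real (Suc n choose Suc j) * (real (Suc j) * a ^ j * b ^ (n - j)))"
    by (subst sum.lessThan_Suc_shift) simp
  also have "\<dots> = (\<Sum>j<m. real (Suc n) * (real (n choose j) * (a ^ j * b ^ (n - j))))"
  proof (rule sum.cong)
    fix j
    have "real (Suc n choose Suc j) * real (Suc j) = real (Suc n) * real (n choose j)"
      using Suc_times_binomial_eq[of n j] by (metis of_nat_mult)
    then show "real (Suc n choose Suc j) * (real (Suc j) * a ^ j * b ^ (n - j))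
        = real (Suc n) * (real (n choose j) * (a ^ j * b ^ (n - j)))"
      by (metis mult.assoc)
  qed simp
  finally show ?thesis by (simp add: binomial_head_def sum_distrib_left)
qed

lemma binomial_head_deriv_snd:
  assumes "m \<le> Suc n"
  shows "((\<lambda>b. binomial_head (Suc n) m a b) has_real_derivative
     real (Suc n) * binomial_head n m a b) (at b)"
proof -
  have "((\<lambda>b. binomial_head (Suc n) m a b) has_real_derivative
     (\<Sum>j<m. real (Suc n choose j) * (a ^ j * (real (Suc n - j) * b ^ (Suc n - j - 1))))) (at b)"
    unfolding binomial_head_def by (auto intro!: derivative_eq_intros sum.cong)
  also have "(\<Sum>j<m. real (Suc n choose j) * (a ^ j * (real (Suc n - j) * b ^ (Suc n - j - 1))))
      = (\<Sum>j<m. real (Suc n) * (real (n choose j) * (a ^ j * b ^ (n - j))))"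
  proof (rule sum.cong)
    fix j assume "j \<in> {..<m}"
    then have e: "Suc n - j - 1 = n - j" using assms by auto
    have "real (Suc n - j) * real (Suc n choose j) = real (Suc n) * real (n choose j)"
      using binomial_absorb_comp[of "Suc n" j] by (metis diff_Suc_1 of_nat_mult)
    then show "real (Suc n choose j) * (a ^ j * (real (Suc n - j) * b ^ (Suc n - j - 1)))
        = real (Suc n) * (real (n choose j) * (a ^ j * b ^ (n - j)))"
      unfolding e by (metis mult.assoc mult.left_commute)
  qed simp
  finally show ?thesis by (simp add: binomial_head_def sum_distrib_left)
qed

lemma continuous_on_binomial_head [continuous_intros]:
  "continuous_on S f \<Longrightarrow> continuous_on S g \<Longrightarrow>
    continuous_on S (\<lambda>x. binomial_head n m (f x) (g x))"
  unfolding binomial_head_def by (intro continuous_intros)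

context telegraph_speeds begin

text \<open>
  The volumes for a downward start with \<open>2 * k + 1\<close> jumps and for an upward start with \<open>2 * k\<close>
  jumps. In both cases the particle ends moving up.
\<close>
definition down_poly :: "nat \<Rightarrow> real \<Rightarrow> real \<Rightarrow> real" where
  "down_poly k a b = binomial_head (2 * k + 1) (k + 1) a b
     - (c2 / c1) ^ (2 * k) * binomial_head (2 * k + 1) k (b / (c2 / c1)\<^sup>2) a"

definition up_poly :: "nat \<Rightarrow> real \<Rightarrow> real \<Rightarrow> real" where
  "up_poly k a b = binomial_head (2 * k) k a b
     - (c2 / c1) ^ (2 * k) * binomial_head (2 * k) k (b / (c2 / c1)\<^sup>2) a"

lemma down_poly_deriv:
  "((\<lambda>a. down_poly k a b) has_real_derivative real (2 * k + 1) * up_poly k a b) (at a)"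
proof -
  have "((\<lambda>a. down_poly k a b) has_real_derivative
      real (Suc (2 * k)) * binomial_head (2 * k) k a b
      - (c2 / c1) ^ (2 * k) * (real (Suc (2 * k)) * binomial_head (2 * k) k (b / (c2 / c1)\<^sup>2) a)) (at a)"
    unfolding down_poly_def add_2_eq_Suc' Suc_eq_plus1[symmetric]
    by (intro DERIV_diff DERIV_cmult binomial_head_deriv_fst binomial_head_deriv_snd) simp
  then show ?thesis by (simp add: up_poly_def algebra_simps)
qed

lemma up_poly_deriv:
  "((\<lambda>b. up_poly (Suc k) a b) has_real_derivative real (2 * k + 2) * down_poly k a b) (at b)"
proof -
  let ?r = "c2 / c1"
  have "((\<lambda>b. binomial_head (Suc (2 * k + 1)) (Suc k) (b / ?r\<^sup>2) a) has_real_derivative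
      real (Suc (2 * k + 1)) * binomial_head (2 * k + 1) k (b / ?r\<^sup>2) a * (1 / ?r\<^sup>2)) (at b)"
    by (rule DERIV_chain2[OF binomial_head_deriv_fst DERIV_cdivide[OF DERIV_ident]])
  then have "((\<lambda>b. binomial_head (Suc (2 * k + 1)) (Suc k) a b
        - ?r ^ (2 * Suc k) * binomial_head (Suc (2 * k + 1)) (Suc k) (b / ?r\<^sup>2) a) has_real_derivative
      real (Suc (2 * k + 1)) * binomial_head (2 * k + 1) (Suc k) a b
      - ?r ^ (2 * Suc k) * (real (Suc (2 * k + 1)) * binomial_head (2 * k + 1) k (b / ?r\<^sup>2) a * (1 / ?r\<^sup>2))) (at b)"
    by (intro DERIV_diff DERIV_cmult binomial_head_deriv_snd) auto
  moreover have "?r ^ (2 * Suc k) * (1 / ?r\<^sup>2) = ?r ^ (2 * k)"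
    using c1_pos c2_pos by (simp add: power_add power2_eq_square)
  then have "?r ^ (2 * Suc k) * (x * y * (1 / ?r\<^sup>2)) = x * (?r ^ (2 * k) * y)" for x y
    by (metis mult.assoc mult.commute)
  moreover have "2 * Suc k = Suc (2 * k + 1)" by simp
  ultimately show ?thesis
    unfolding down_poly_def up_poly_def by (simp add: right_diff_distrib del: power_Suc)
qed

lemma down_poly_zero: "down_poly k 0 b = b ^ (2 * k + 1)"
proof -
  have "binomial_head (2 * k + 1) (k + 1) 0 b = b ^ (2 * k + 1)"
    by (simp add: binomial_head_def sum.lessThan_Suc_shift del: sum.lessThan_Suc)
  moreover have "binomial_head (2 * k + 1) k (b / (c2 / c1)\<^sup>2) 0 = 0"
    unfolding binomial_head_def by (rule sum.neutral) (auto simp: power_0_left)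
  ultimately show ?thesis by (simp add: down_poly_def)
qed

text \<open>On the line \<open>b = r * a\<close> the truncated expansion and its reflection agree term by term.\<close>
lemma up_poly_zero: "up_poly k a ((c2 / c1) * a) = 0"
proof -
  let ?r = "c2 / c1"
  have r: "?r \<noteq> 0" using c1_pos c2_pos by simp
  have "a ^ j * (?r * a) ^ (2 * k - j) = ?r ^ (2 * k) * ((?r * a / ?r\<^sup>2) ^ j * a ^ (2 * k - j))"
    if "j < k" for j
  proof -
    have "?r ^ (2 * k) = ?r ^ (2 * k - j) * ?r ^ j"
      using that by (simp flip: power_add)
    moreover have "?r * a / ?r\<^sup>2 = a / ?r"
      using r by (simp only: power2_eq_square) (simp add: field_simps)
    ultimately show ?thesis
      using r by (simp only: power_mult_distrib power_divide) (simp add: field_simps)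
  qed
  then have "binomial_head (2 * k) k a (?r * a) = ?r ^ (2 * k) * binomial_head (2 * k) k (?r * a / ?r\<^sup>2) a"
    unfolding binomial_head_def sum_distrib_left
    by (intro sum.cong refl) (simp only: lessThan_iff mult.left_commute)
  then show ?thesis by (simp add: up_poly_def)
qed

lemma continuous_on_down_up_poly [continuous_intros]:
  assumes "continuous_on S f" "continuous_on S g"
  shows "continuous_on S (\<lambda>x. down_poly k (f x) (g x))"
    "continuous_on S (\<lambda>x. up_poly k (f x) (g x))"
  unfolding down_poly_def up_poly_def 
  by (intro continuous_intros assms; use c1_pos c2_pos in simp)+

end

lemma uniformly_close_on_box:
  fixes F :: "real \<Rightarrow> real \<Rightarrow> real"
  assumes "continuous_on UNIV (\<lambda>p. F (fst p) (snd p))" "0 < \<epsilon>"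
  obtains \<delta> where "0 < \<delta>"
    "\<And>a a' b b'. a \<in> {0..A} \<Longrightarrow> a' \<in> {0..A} \<Longrightarrow> b \<in> {0..B} \<Longrightarrow> b' \<in> {0..B} \<Longrightarrow>
       \<bar>a - a'\<bar> + \<bar>b - b'\<bar> < \<delta> \<Longrightarrow> \<bar>F a b - F a' b'\<bar> < \<epsilon>"
proof -
  have "uniformly_continuous_on ({0..A} \<times> {0..B}) (\<lambda>p. F (fst p) (snd p))"
    by (intro compact_uniformly_continuous compact_Times continuous_on_subset[OF assms(1)]) auto
  then obtain \<delta> where \<delta>: "\<delta> > 0" "\<And>p q. p \<in> {0..A} \<times> {0..B} \<Longrightarrow> q \<in> {0..A} \<times> {0..B} \<Longrightarrow>
      dist q p < \<delta> \<Longrightarrow> dist (F (fst q) (snd q)) (F (fst p) (snd p)) < \<epsilon>"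
    using \<open>0 < \<epsilon>\<close> unfolding uniformly_continuous_on_def by metis
  show ?thesis
  proof (rule that[OF \<delta>(1)])
    fix a a' b b' assume *: "a \<in> {0..A}" "a' \<in> {0..A}" "b \<in> {0..B}" "b' \<in> {0..B}"
      "\<bar>a - a'\<bar> + \<bar>b - b'\<bar> < \<delta>"
    have "dist (a, b) (a', b') \<le> \<bar>a - a'\<bar> + \<bar>b - b'\<bar>"
      by (simp add: dist_Pair_Pair dist_real_def sqrt_sum_squares_le_sum_abs)
    with * \<delta>(2)[of "(a', b')" "(a, b)"] show "\<bar>F a b - F a' b'\<bar> < \<epsilon>"
      by (simp add: dist_real_def)
  qed
qed

section \<open>One time step\<close>

lemma exp_tail_le_square:
  fixes x :: real assumes "0 \<le> x"
  shows "1 - exp (- x) - exp (- x) * x \<le> x\<^sup>2"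
proof -
  have "(1 - x) * (1 + x) \<le> exp (- x) * (1 + x)"
    using exp_ge_add_one_self[of "- x"] assms by (intro mult_right_mono) auto
  then show ?thesis by (simp add: algebra_simps power2_eq_square)
qed

context telegraph_speeds begin

lemma stay_event_sets:
  assumes N: "poisson_process M rate N" and "0 \<le> t"
  shows "{\<omega> \<in> space M. N t \<omega> = n \<and> stays_below d (\<lambda>u. N u \<omega>) t \<beta>} \<in> sets M"
  by (rule stay_event_measurable[OF N refl poisson_process_measurable[OF N] \<open>0 \<le> t\<close>])

lemma count_event_sets:
  assumes N: "poisson_process M rate N" and "0 \<le> h"
  shows "{\<omega> \<in> space M. P (N h \<omega>)} \<in> sets M"
  using measurable_sets[OF poisson_process_measurable[OF N \<open>0 \<le> h\<close>], of "Collect P"]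
  by (simp add: vimage_def Int_def conj_commute)

lemma count_stay_event_sets:
  assumes "poisson_process M rate N" "0 \<le> h" "poisson_process M rate N'" "0 \<le> t"
  shows "{\<omega> \<in> space M. N h \<omega> = j \<and> N' t \<omega> = n \<and> stays_below d (\<lambda>u. N' u \<omega>) t \<beta>} \<in> sets M"
proof -
  have "{\<omega> \<in> space M. N h \<omega> = j} \<inter>
      {\<omega> \<in> space M. N' t \<omega> = n \<and> stays_below d (\<lambda>u. N' u \<omega>) t \<beta>} \<in> sets M"
    by (intro sets.Int stay_event_sets[OF assms(3,4)] count_event_sets[OF assms(1,2)])
  moreover have "{\<omega> \<in> space M. N h \<omega> = j} \<inter>
      {\<omega> \<in> space M. N' t \<omega> = n \<and> stays_below d (\<lambda>u. N' u \<omega>) t \<beta>}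
    = {\<omega> \<in> space M. N h \<omega> = j \<and> N' t \<omega> = n \<and> stays_below d (\<lambda>u. N' u \<omega>) t \<beta>}"
    by blast
  ultimately show ?thesis by simp
qed

lemma prob_two_jumps_le:
  assumes N: "poisson_process M rate N" and h: "0 \<le> h"
  shows "measure M {\<omega> \<in> space M. 2 \<le> N h \<omega>} \<le> (rate * h)\<^sup>2"
proof -
  interpret prob_space M using N by (rule poisson_process_prob_space)
  note [measurable] = poisson_process_measurable[OF N h]
  have "1 = prob ({\<omega> \<in> space M. 2 \<le> N h \<omega>} \<union> ({\<omega> \<in> space M. N h \<omega> = 0} \<union> {\<omega> \<in> space M. N h \<omega> = 1}))"
    by (subst prob_space[symmetric]) (rule arg_cong[where f=prob], auto)
  also have "\<dots> = prob {\<omega> \<in> space M. 2 \<le> N h \<omega>} + (prob {\<omega> \<in> space M. N h \<omega> = 0} + prob {\<omega> \<in> space M. N h \<omega> = 1})"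
    by (subst finite_measure_Union; (subst finite_measure_Union)?; auto intro: count_event_sets[OF N h])
  finally have "prob {\<omega> \<in> space M. 2 \<le> N h \<omega>} = 1 - exp (- (rate * h)) - exp (- (rate * h)) * (rate * h)"
    by (simp add: poisson_process_prob[OF N h])
  also have "\<dots> \<le> (rate * h)\<^sup>2"
    using N h by (intro exp_tail_le_square) (auto simp: poisson_process_def)
  finally show ?thesis .
qed

lemma stay_prob_no_jump:
  assumes N: "poisson_process M rate N" and h: "0 \<le> h" "h \<le> t" and "0 \<le> \<beta>"
  shows "measure M {\<omega> \<in> space M. N h \<omega> = 0 \<and> N t \<omega> = n \<and> stays_below d (\<lambda>u. N u \<omega>) t \<beta>}
    = exp (- (rate * h)) * stay_prob M (restart h N) d n (t - h) (\<beta> - vel d * h)"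
proof -
  have "{\<omega> \<in> space M. N h \<omega> = 0 \<and> N t \<omega> = n \<and> stays_below d (\<lambda>u. N u \<omega>) t \<beta>}
    = {\<omega> \<in> space M. N h \<omega> = 0 \<and> restart h N (t - h) \<omega> = n \<and>
        stays_below d (\<lambda>u. restart h N u \<omega>) (t - h) (\<beta> - vel d * h)}"
    using stays_below_no_jump[OF poisson_process_mono[OF N] h poisson_process_zero[OF N] _ \<open>0 \<le> \<beta>\<close>]
    by (auto simp: restart_def)
  then show ?thesis
    using stay_prob_after_restart[OF N h(1), of "t - h" 0] h by simp
qed

text \<open>
  The three terms account for no jump, one jump and at least two jumps before \<open>h\<close>; after one jump
  the direction is reversed.
\<close>
lemma stay_prob_le:
  assumes N: "poisson_process M rate N" and h: "0 \<le> h" "h \<le> t" and "0 \<le> \<beta>"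
  shows "stay_prob M N d (Suc n) t \<beta>
    \<le> exp (- (rate * h)) * stay_prob M (restart h N) d (Suc n) (t - h) (\<beta> - vel d * h)
      + exp (- (rate * h)) * (rate * h) * stay_prob M (restart h N) (Suc d) n (t - h) (\<beta> + c2 * h)
      + (rate * h)\<^sup>2"
proof -
  interpret prob_space M using N by (rule poisson_process_prob_space)
  have t: "0 \<le> t" using h by simp
  let ?E = "{\<omega> \<in> space M. N t \<omega> = Suc n \<and> stays_below d (\<lambda>u. N u \<omega>) t \<beta>}"
  let ?none = "{\<omega> \<in> space M. N h \<omega> = 0 \<and> N t \<omega> = Suc n \<and> stays_below d (\<lambda>u. N u \<omega>) t \<beta>}"
  let ?once = "{\<omega> \<in> space M. N h \<omega> = 1 \<and> restart h N (t - h) \<omega> = n \<and>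
        stays_below (Suc d) (\<lambda>u. restart h N u \<omega>) (t - h) (\<beta> + c2 * h)}"
  let ?more = "{\<omega> \<in> space M. 2 \<le> N h \<omega>}"
  have E0: "?none \<in> events"
    by (rule count_stay_event_sets[OF N h(1) N t])
  have E1: "?once \<in> events"
    by (rule count_stay_event_sets[OF N h(1) poisson_process_restart[OF N h(1)]]) (use h in simp)
  have E2: "?more \<in> events" by (rule count_event_sets[OF N h(1)])
  have "?E \<subseteq> ?none \<union> ?once \<union> ?more"
  proof
    fix \<omega> assume \<omega>: "\<omega> \<in> ?E"
    consider "N h \<omega> = 0" | "N h \<omega> = 1" | "2 \<le> N h \<omega>" by linarith
    then show "\<omega> \<in> ?none \<union> ?once \<union> ?more"
    proof cases
      case 2
      then have "stays_below (Suc d) (\<lambda>u. restart h N u \<omega>) (t - h) (\<beta> + c2 * h)"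
        using stays_below_after_jump[OF poisson_process_mono[OF N] h, of \<omega> d \<beta>] \<omega>
        by (simp add: restart_def)
      then show ?thesis using 2 \<omega> by (simp add: restart_def)
    qed (use \<omega> in auto)
  qed
  then have "prob ?E \<le> prob (?none \<union> ?once \<union> ?more)"
    using E0 E1 E2 by (intro finite_measure_mono) auto
  moreover have "prob (?none \<union> ?once \<union> ?more) \<le> prob (?none \<union> ?once) + prob ?more"
    using E0 E1 E2 by (intro measure_Un_le) auto
  moreover have "prob (?none \<union> ?once) \<le> prob ?none + prob ?once"
    using E0 E1 by (rule measure_Un_le)
  ultimately have "stay_prob M N d (Suc n) t \<beta> \<le> prob ?none + prob ?once + prob ?more"
    unfolding stay_prob_def by linarith
  moreover have "prob ?once = exp (- (rate * h)) * (rate * h)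
      * stay_prob M (restart h N) (Suc d) n (t - h) (\<beta> + c2 * h)"
    using stay_prob_after_restart[OF N h(1), of "t - h" 1] h by simp
  ultimately show ?thesis
    using stay_prob_no_jump[OF N h \<open>0 \<le> \<beta>\<close>, of "Suc n" d] prob_two_jumps_le[OF N h(1)]
    by linarith
qed

lemma stay_prob_ge:
  assumes N: "poisson_process M rate N" and h: "0 \<le> h" "h \<le> t" and "0 \<le> \<beta>"
  shows "exp (- (rate * h)) * stay_prob M (restart h N) d (Suc n) (t - h) (\<beta> - vel d * h)
      + exp (- (rate * h)) * (rate * h) * stay_prob M (restart h N) (Suc d) n (t - h) (\<beta> - c1 * h)
    \<le> stay_prob M N d (Suc n) t \<beta>"
proof -
  interpret prob_space M using N by (rule poisson_process_prob_space)
  have t: "0 \<le> t" using h by simp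
  let ?E = "{\<omega> \<in> space M. N t \<omega> = Suc n \<and> stays_below d (\<lambda>u. N u \<omega>) t \<beta>}"
  let ?none = "{\<omega> \<in> space M. N h \<omega> = 0 \<and> N t \<omega> = Suc n \<and> stays_below d (\<lambda>u. N u \<omega>) t \<beta>}"
  let ?once = "{\<omega> \<in> space M. N h \<omega> = 1 \<and> restart h N (t - h) \<omega> = n \<and>
        stays_below (Suc d) (\<lambda>u. restart h N u \<omega>) (t - h) (\<beta> - c1 * h)}"
  have E0: "?none \<in> events"
    by (rule count_stay_event_sets[OF N h(1) N t])
  have E1: "?once \<in> events"
    by (rule count_stay_event_sets[OF N h(1) poisson_process_restart[OF N h(1)]]) (use h in simp)
  have "?once \<subseteq> ?E"
  proof
    fix \<omega> assume \<omega>: "\<omega> \<in> ?once"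
    then have Nh: "N h \<omega> = 1"
      and "stays_below (Suc d) (\<lambda>u. N (h + u) \<omega> - N h \<omega>) (t - h) (\<beta> - c1 * h)"
      by (auto simp: restart_def)
    then have "stays_below d (\<lambda>u. N u \<omega>) t \<beta>"
      using \<omega> by (intro stays_below_before_jump[OF poisson_process_mono[OF N] h]) auto
    moreover have "N t \<omega> = Suc n"
      using \<omega> poisson_process_le[OF N _ h, of \<omega>] by (auto simp: restart_def)
    ultimately show "\<omega> \<in> ?E" using \<omega> by blast
  qed
  have "prob ?none + prob ?once = prob (?none \<union> ?once)"
    using E0 E1 by (intro finite_measure_Union[symmetric]) auto
  also have "\<dots> \<le> prob ?E"
    using \<open>?once \<subseteq> ?E\<close> by (intro finite_measure_mono stay_event_sets[OF N t]) auto
  finally have "prob ?none + prob ?once \<le> stay_prob M N d (Suc n) t \<beta>"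
    by (simp only: stay_prob_def)
  moreover have "prob ?once = exp (- (rate * h)) * (rate * h)
      * stay_prob M (restart h N) (Suc d) n (t - h) (\<beta> - c1 * h)"
    using stay_prob_after_restart[OF N h(1), of "t - h" 1] h by simp
  ultimately show ?thesis
    using stay_prob_no_jump[OF N h \<open>0 \<le> \<beta>\<close>, of "Suc n" d]
    by linarith
qed

text \<open>
  The factor turns a probability into \<open>((c1 + c2) * t) ^ n\<close> times the conditional probability given
  \<open>n\<close> jumps (see \<open>stay_volume_count\<close>). Geometrically this is \<open>n!\<close> times the volume of the set of
  admissible jump times, with time measured in units of \<open>1 / (c1 + c2)\<close>. In this normalization the
  exponential factors of the first-jump recursion cancel.
\<close>
definition stay_volume :: "'a measure \<Rightarrow> real \<Rightarrow> (real \<Rightarrow> 'a \<Rightarrow> nat) \<Rightarrow> nat \<Rightarrow> nat \<Rightarrow> real \<Rightarrow> real \<Rightarrow> real" where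
  "stay_volume M rate N d n t \<beta> =
     exp (rate * t) * fact n * ((c1 + c2) / rate) ^ n * stay_prob M N d n t \<beta>"

lemma stay_volume_nonneg: "0 < rate \<Longrightarrow> 0 \<le> stay_volume M rate N d n t \<beta>"
  using c1_pos c2_pos by (simp add: stay_volume_def stay_prob_def)

lemma stay_volume_count:
  assumes N: "poisson_process M rate N" and "0 \<le> t"
  shows "exp (rate * t) * fact n * ((c1 + c2) / rate) ^ n * measure M {\<omega> \<in> space M. N t \<omega> = n}
    = ((c1 + c2) * t) ^ n"
proof -
  have "0 < rate" using N by (simp add: poisson_process_def)
  then show ?thesis
    by (simp add: poisson_process_prob[OF N \<open>0 \<le> t\<close>] exp_minus power_mult_distrib power_divide)
qed

lemma stay_volume_le_total:
  assumes N: "poisson_process M rate N" and t: "0 \<le> t"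
  shows "stay_volume M rate N d n t \<beta> \<le> ((c1 + c2) * t) ^ n"
proof -
  interpret prob_space M using N by (rule poisson_process_prob_space)
  have rate: "0 < rate" using N by (simp add: poisson_process_def)
  have "stay_prob M N d n t \<beta> \<le> measure M {\<omega> \<in> space M. N t \<omega> = n}"
    unfolding stay_prob_def by (intro finite_measure_mono count_event_sets[OF N t]) auto
  then show ?thesis
    unfolding stay_volume_def stay_volume_count[OF N t, symmetric]
    using rate c1_pos c2_pos by (intro mult_left_mono) auto
qed

lemma stay_volume_total:
  assumes N: "poisson_process M rate N" and t: "0 \<le> t" and "c1 * t \<le> \<beta>"
  shows "stay_volume M rate N d n t \<beta> = ((c1 + c2) * t) ^ n"
proof -
  have "{\<omega> \<in> space M. N t \<omega> = n \<and> stays_below d (\<lambda>u. N u \<omega>) t \<beta>} = {\<omega> \<in> space M. N t \<omega> = n}"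
    using stays_below_trivial[OF poisson_process_mono[OF N] assms(3)] by auto
  then show ?thesis
    by (simp add: stay_volume_def stay_prob_def stay_volume_count[OF N t, symmetric])
qed

lemma stay_volume_restart_restart:
  assumes N: "poisson_process M rate N" and "0 \<le> h" "0 \<le> h'" "0 \<le> t"
  shows "stay_volume M rate (restart h' (restart h N)) d n t \<beta> = stay_volume M rate (restart (h + h') N) d n t \<beta>"
proof -
  have "stays_below d (\<lambda>u. restart h' (restart h N) u \<omega>) t \<beta> = stays_below d (\<lambda>u. restart (h + h') N u \<omega>) t \<beta>"
    if "\<omega> \<in> space M" for \<omega>
    using restart_restart[OF N assms(2,3) _ that]
    by (auto simp: stays_below_def disp_def intro!: ball_cong arg_cong2[where f="(\<le>)"] integral_cong)
  then show ?thesis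
    using restart_restart[OF N assms(2-4)]
    by (auto simp: stay_volume_def stay_prob_def intro!: arg_cong[where f="measure M"])
qed

lemma stay_volume_restart_0:
  assumes N: "poisson_process M rate N"
  shows "stay_volume M rate (restart 0 N) d n t \<beta> = stay_volume M rate N d n t \<beta>"
  using poisson_process_zero[OF N]
  by (auto simp: stay_volume_def stay_prob_def restart_def intro!: arg_cong[where f="measure M"])

lemma stay_volume_cong_parity:
  "stay_volume M rate N (Suc (Suc d)) n t \<beta> = stay_volume M rate N d n t \<beta>"
  by (simp add: stay_volume_def stay_prob_def stays_below_Suc_Suc)

definition jump_error :: "real \<Rightarrow> nat \<Rightarrow> real \<Rightarrow> real" where
  "jump_error rate n t = exp (rate * t) * fact n * ((c1 + c2) / rate) ^ n * rate\<^sup>2"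

lemma stay_volume_step:
  assumes N: "poisson_process M rate N" and h: "0 \<le> h" "h \<le> t" and "0 \<le> \<beta>"
  shows "stay_volume M rate N d (Suc n) t \<beta>
    \<le> stay_volume M rate (restart h N) d (Suc n) (t - h) (\<beta> - vel d * h)
      + real (Suc n) * (c1 + c2) * h * stay_volume M rate (restart h N) (Suc d) n (t - h) (\<beta> + c2 * h)
      + jump_error rate (Suc n) t * h\<^sup>2" (is ?le)
  and "stay_volume M rate (restart h N) d (Suc n) (t - h) (\<beta> - vel d * h)
      + real (Suc n) * (c1 + c2) * h * stay_volume M rate (restart h N) (Suc d) n (t - h) (\<beta> - c1 * h)
    \<le> stay_volume M rate N d (Suc n) t \<beta>" (is ?ge)
proof -
  have rate: "0 < rate" using N by (simp add: poisson_process_def)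
  \<comment> \<open>The factor of \<open>stay_volume\<close>; multiplying the bounds on probabilities by it gives the claim.\<close>
  define K where "K = exp (rate * t) * fact (Suc n) * ((c1 + c2) / rate) ^ Suc n"
  have K: "0 \<le> K" using rate c1_pos c2_pos by (simp add: K_def)
  have e: "exp (rate * t) * exp (- (rate * h)) = exp (rate * (t - h))"
    by (simp add: algebra_simps flip: exp_add)
  have no_jump: "K * (exp (- (rate * h)) * stay_prob M N' d (Suc n) (t - h) \<beta>')
      = stay_volume M rate N' d (Suc n) (t - h) \<beta>'" for N' \<beta>' and M :: "'a measure"
    unfolding K_def stay_volume_def e[symmetric] by (simp only: mult_ac)
  have one_jump: "K * (exp (- (rate * h)) * (rate * h) * stay_prob M N' (Suc d) n (t - h) \<beta>')
      = real (Suc n) * (c1 + c2) * h * stay_volume M rate N' (Suc d) n (t - h) \<beta>'"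
    for N' \<beta>' and M :: "'a measure"
    unfolding K_def stay_volume_def e[symmetric] using rate by (simp add: field_simps)
  show ?le
    using mult_left_mono[OF stay_prob_le[OF N h \<open>0 \<le> \<beta>\<close>, of d n] K]
    unfolding distrib_left no_jump one_jump
    by (simp add: stay_volume_def[of M rate N] K_def jump_error_def power_mult_distrib mult_ac)
  show ?ge
    using mult_left_mono[OF stay_prob_ge[OF N h \<open>0 \<le> \<beta>\<close>, of d n] K]
    unfolding distrib_left no_jump one_jump
    by (simp add: stay_volume_def[of M rate N] K_def)
qed

end

section \<open>Integration along a line of constant velocity\<close>

context telegraph_speeds begin

lemma jump_error_mono:
  assumes "0 < rate" "s \<le> t"
  shows "jump_error rate n s \<le> jump_error rate n t"
  unfolding jump_error_def
  using assms c1_pos c2_pos by (intro mult_right_mono) auto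

text \<open>
  This is the integrated form of the differential equation. Follow the particle while it keeps its
  initial velocity: at time \<open>s\<close> the distance to the level is \<open>\<beta> - vel d * s\<close>. The function \<open>G\<close> is
  the conjectured volume along this line and \<open>g\<close> the volume after a jump at time \<open>s\<close>. The hypotheses
  \<open>upper\<close> and \<open>lower\<close> ask that \<open>g\<close> approximates the one-jump terms of \<open>stay_volume_step\<close> in only
  one direction each, since the level in these terms may fall outside the range in which the
  volume is given by a polynomial.
\<close>
lemma stay_volume_along_characteristic:
  assumes N: "poisson_process M rate N" and x: "0 \<le> x" "x \<le> t"
    and level: "\<And>s. 0 \<le> s \<Longrightarrow> s \<le> x \<Longrightarrow> 0 \<le> \<beta> - vel d * s"
    and G: "\<And>s. 0 \<le> s \<Longrightarrow> s \<le> x \<Longrightarrow>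
        (G has_real_derivative - (real (Suc n) * (c1 + c2) * g s)) (at s)"
    and g: "continuous_on {0..x} g"
    and terminal: "stay_volume M rate (restart x N) d (Suc n) (t - x) (\<beta> - vel d * x) = G x"
    and upper: "\<And>\<epsilon>. 0 < \<epsilon> \<Longrightarrow> \<exists>\<delta>>0. \<forall>s h. 0 \<le> s \<and> 0 < h \<and> h < \<delta> \<and> s + h \<le> x \<longrightarrow>
        stay_volume M rate (restart (s + h) N) (Suc d) n (t - (s + h)) (\<beta> - vel d * s + c2 * h) \<le> g s + \<epsilon>"
    and lower: "\<And>\<epsilon>. 0 < \<epsilon> \<Longrightarrow> \<exists>\<delta>>0. \<forall>s h. 0 \<le> s \<and> 0 < h \<and> h < \<delta> \<and> s + h \<le> x \<longrightarrow>
        g s - \<epsilon> \<le> stay_volume M rate (restart (s + h) N) (Suc d) n (t - (s + h)) (\<beta> - vel d * s - c1 * h)"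
  shows "stay_volume M rate N d (Suc n) t \<beta> = G 0"
proof -
  have rate: "0 < rate" using N by (simp add: poisson_process_def)
  define Q where "Q s = stay_volume M rate (restart s N) d (Suc n) (t - s) (\<beta> - vel d * s)" for s
  define c where "c = real (Suc n) * (c1 + c2)"
  have c: "0 < c" using c1_pos c2_pos by (simp add: c_def)
  define K where "K = jump_error rate (Suc n) t"
  have K: "0 \<le> K" using rate c1_pos c2_pos by (simp add: K_def jump_error_def)
  have "\<bar>Q 0 - G 0\<bar> \<le> 0"
  proof (rule telescoping_nonpos[where D="\<lambda>s. \<bar>Q s - G s\<bar>" and x=x])
    show "\<bar>Q x - G x\<bar> \<le> 0" using terminal by (simp add: Q_def)
    fix \<epsilon> :: real assume "0 < \<epsilon>"
    \<comment> \<open>The allowance is split into thirds: one for the error of a multiple jump, one for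
      \<open>upper\<close> or \<open>lower\<close>, one for the oscillation of \<open>g\<close> within a step.\<close>
    define \<eta> where "\<eta> = \<epsilon> / (3 * c)"
    have \<eta>: "0 < \<eta>" "c * \<eta> = \<epsilon> / 3" using c \<open>0 < \<epsilon>\<close> by (simp_all add: \<eta>_def)
    obtain \<delta>1 where \<delta>1: "\<delta>1 > 0" "\<And>s h. 0 \<le> s \<Longrightarrow> 0 < h \<Longrightarrow> h < \<delta>1 \<Longrightarrow> s + h \<le> x \<Longrightarrow>
        stay_volume M rate (restart (s + h) N) (Suc d) n (t - (s + h)) (\<beta> - vel d * s + c2 * h) \<le> g s + \<eta>"
      using upper[OF \<eta>(1)] by blast
    obtain \<delta>2 where \<delta>2: "\<delta>2 > 0" "\<And>s h. 0 \<le> s \<Longrightarrow> 0 < h \<Longrightarrow> h < \<delta>2 \<Longrightarrow> s + h \<le> x \<Longrightarrow>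
        g s - \<eta> \<le> stay_volume M rate (restart (s + h) N) (Suc d) n (t - (s + h)) (\<beta> - vel d * s - c1 * h)"
      using lower[OF \<eta>(1)] by blast
    have "uniformly_continuous_on {0..x} g"
      by (rule compact_uniformly_continuous[OF g]) simp
    then obtain \<delta>3 where \<delta>3: "\<delta>3 > 0" "\<And>s s'. s \<in> {0..x} \<Longrightarrow> s' \<in> {0..x} \<Longrightarrow> \<bar>s' - s\<bar> < \<delta>3 \<Longrightarrow> \<bar>g s' - g s\<bar> < \<eta>"
      using \<eta>(1) unfolding uniformly_continuous_on_def dist_real_def by metis
    define \<delta> where "\<delta> = min (min \<delta>1 \<delta>2) (min \<delta>3 (\<epsilon> / (3 * (K + 1))))"
    show "\<exists>\<delta>>0. \<forall>s h. 0 \<le> s \<and> 0 < h \<and> h < \<delta> \<and> s + h \<le> x \<longrightarrow>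
        \<bar>Q s - G s\<bar> \<le> \<bar>Q (s + h) - G (s + h)\<bar> + \<epsilon> * h"
    proof (intro exI[of _ \<delta>] conjI allI impI)
      show "0 < \<delta>" using \<delta>1 \<delta>2 \<delta>3 K \<open>0 < \<epsilon>\<close> by (simp add: \<delta>_def)
      fix s h assume asm: "0 \<le> s \<and> 0 < h \<and> h < \<delta> \<and> s + h \<le> x"
      then have sh: "0 \<le> s" "0 < h" "s + h \<le> x" "h < \<delta>1" "h < \<delta>2" "h < \<delta>3" "h < \<epsilon> / (3 * (K + 1))"
        by (auto simp: \<delta>_def)
      define q1 where "q1 = stay_volume M rate (restart (s + h) N) (Suc d) n (t - (s + h)) (\<beta> - vel d * s + c2 * h)"
      define q2 where "q2 = stay_volume M rate (restart (s + h) N) (Suc d) n (t - (s + h)) (\<beta> - vel d * s - c1 * h)"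
      have q: "q1 \<le> g s + \<eta>" "g s - \<eta> \<le> q2"
        using \<delta>1(2) \<delta>2(2) sh by (auto simp: q1_def q2_def)
      have "(K + 1) * h \<le> \<epsilon> / 3"
        using sh(7) K by (simp add: field_simps)
      then have Kh: "K * h\<^sup>2 \<le> \<epsilon> / 3 * h"
        using sh(2) mult_right_mono[of "K * h" "\<epsilon> / 3" h] by (simp add: power2_eq_square algebra_simps)
      have h0: "0 \<le> h" and sx: "s \<le> x" and st: "h \<le> t - s" "0 \<le> t - (s + h)"
        using sh x by auto
      note rs = stay_volume_restart_restart[OF N \<open>0 \<le> s\<close> h0 st(2)]
      have level_eq: "\<beta> - vel d * s - vel d * h = \<beta> - vel d * (s + h)" "t - s - h = t - (s + h)"
        by (simp_all add: algebra_simps)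
      note step = stay_volume_step[OF poisson_process_restart[OF N \<open>0 \<le> s\<close>] h0 st(1) level[OF sh(1) sx],
          of d n, unfolded level_eq rs, folded Q_def q1_def q2_def c_def]
      have "jump_error rate (Suc n) (t - s) * h\<^sup>2 \<le> K * h\<^sup>2"
        unfolding K_def using rate sh by (intro mult_right_mono jump_error_mono) auto
      then have up: "Q s \<le> Q (s + h) + c * h * q1 + K * h\<^sup>2"
        using step(1) by linarith
      have lo: "Q (s + h) + c * h * q2 \<le> Q s"
        using step(2) by simp
      obtain \<xi> where \<xi>: "s < \<xi>" "\<xi> < s + h" "G (s + h) - G s = (s + h - s) * - (c * g \<xi>)"
        using MVT2[of s "s + h" G "\<lambda>s. - (c * g s)"] G sh unfolding c_def by auto
      have "\<bar>g \<xi> - g s\<bar> < \<eta>"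
        using \<delta>3(2)[of s \<xi>] \<xi> sh by auto
      then have g1: "g s \<le> g \<xi> + \<eta>" "g \<xi> - \<eta> \<le> g s" by auto
      have Gs: "G s = G (s + h) + c * h * g \<xi>" using \<xi>(3) by (simp add: algebra_simps)
      have ch: "0 \<le> c * h" using c sh by simp
      have che: "c * h * \<eta> = \<epsilon> / 3 * h" using \<eta>(2) by (simp add: mult.commute mult.left_commute)
      have expand: "c * h * (g \<xi> + 2 * \<eta>) = c * h * g \<xi> + 2 * (\<epsilon> / 3 * h)"
        "c * h * (g \<xi> - 2 * \<eta>) = c * h * g \<xi> - 2 * (\<epsilon> / 3 * h)"
        unfolding che[symmetric] by (simp_all add: algebra_simps)
      have "0 \<le> \<epsilon> * h" using \<open>0 < \<epsilon>\<close> sh by simp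
      have "c * h * q1 \<le> c * h * (g \<xi> + 2 * \<eta>)"
        using q g1 by (intro mult_left_mono ch) auto
      then have "Q s - G s \<le> Q (s + h) - G (s + h) + \<epsilon> * h"
        using up Kh Gs unfolding expand by simp
      moreover have "c * h * (g \<xi> - 2 * \<eta>) \<le> c * h * q2"
        using q g1 by (intro mult_left_mono ch) auto
      then have "Q (s + h) - G (s + h) - \<epsilon> * h \<le> Q s - G s"
        using lo Gs \<open>0 \<le> \<epsilon> * h\<close> unfolding expand by simp
      ultimately show "\<bar>Q s - G s\<bar> \<le> \<bar>Q (s + h) - G (s + h)\<bar> + \<epsilon> * h" by linarith
    qed
  qed (fact x)
  then show ?thesis
    by (simp add: Q_def stay_volume_restart_0[OF N])
qed

text \<open>
  With a downward start and a single jump at time \<open>\<tau>\<close>, the final position is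
  \<open>c1 * t - (c1 + c2) * \<tau>\<close>, and the maximum is the larger of this value and \<open>0\<close>. Here and in the
  converse below, the time of the jump is expressed through the values of the path.
\<close>
lemma one_jump_stay_imp_no_early_jump:
  assumes m: "mono_on {0..} m" and y: "0 \<le> y" "y \<le> t" and "m t = 1"
    and stay: "stays_below 0 m t \<beta>" and late: "(c1 + c2) * y < c1 * t - \<beta>"
  shows "m y = 0"
proof (rule ccontr)
  assume "m y \<noteq> 0"
  have one: "m u = 1" if "y \<le> u" "u \<le> t" for u
  proof -
    have "m y \<le> m u" "m u \<le> m t" using m that y by (auto simp: mono_on_def)
    then show ?thesis using \<open>m y \<noteq> 0\<close> \<open>m t = 1\<close> by linarith
  qed
  have "disp (0 + m y) (\<lambda>v. m (y + v) - m y) (t - y) \<le> \<beta> + c2 * y"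
    using stays_below_after_jump[OF m y stay] y by (auto simp: stays_below_def)
  moreover have "disp (0 + m y) (\<lambda>v. m (y + v) - m y) (t - y) = vel (0 + m y + 0) * (t - y)"
    using y one by (intro disp_constant_velocity) auto
  ultimately show False
    using late one[of y] y by (simp add: vel_def algebra_simps)
qed

lemma late_jump_imp_stay:
  assumes m: "mono_on {0..} m" and x: "0 \<le> x" "x \<le> t" and "m 0 = 0" "m x = 0" "0 \<le> \<beta>"
    and "c1 * t - \<beta> \<le> (c1 + c2) * x"
  shows "stays_below 0 m t \<beta>"
  by (subst stays_below_no_jump[OF m x \<open>m 0 = 0\<close> \<open>m x = 0\<close> \<open>0 \<le> \<beta>\<close>])
     (rule stays_below_trivial[OF mono_on_shift[OF m x(1)]], use assms in \<open>simp add: vel_def algebra_simps\<close>)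

lemma volume_late_single_jump:
  assumes N: "poisson_process M rate N" and y: "0 \<le> y" "y \<le> t"
  shows "exp (rate * t) * ((c1 + c2) / rate) * measure M {\<omega> \<in> space M. N y \<omega> = 0 \<and> N t \<omega> = 1}
    = (c1 + c2) * (t - y)"
proof -
  have rate: "0 < rate" using N by (simp add: poisson_process_def)
  note rN = poisson_process_restart[OF N y(1)]
  have ty: "0 \<le> t - y" using y by simp
  have "{\<omega> \<in> space M. N y \<omega> = 0 \<and> N t \<omega> = 1}
    = {\<omega> \<in> space M. N y \<omega> = 0 \<and> restart y N (t - y) \<omega> = 1 \<and>
        stays_below 0 (\<lambda>u. restart y N u \<omega>) (t - y) (c1 * (t - y))}"
    using stays_below_trivial[OF poisson_process_mono[OF rN]] by (auto simp: restart_def)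
  then have "measure M {\<omega> \<in> space M. N y \<omega> = 0 \<and> N t \<omega> = 1}
      = exp (- (rate * y)) * stay_prob M (restart y N) 0 1 (t - y) (c1 * (t - y))"
    using stay_prob_after_restart[OF N y(1) ty, of 0] by simp
  moreover have "exp (rate * t) * exp (- (rate * y)) = exp (rate * (t - y))"
    by (simp add: algebra_simps flip: exp_add)
  ultimately have "exp (rate * t) * ((c1 + c2) / rate) * measure M {\<omega> \<in> space M. N y \<omega> = 0 \<and> N t \<omega> = 1}
      = stay_volume M rate (restart y N) 0 1 (t - y) (c1 * (t - y))"
    by (simp add: stay_volume_def mult_ac)
  then show ?thesis
    using stay_volume_total[OF rN ty, of "c1 * (t - y)" 0 1] by simp
qed

text \<open>
  The volume for an upward start without jumps is discontinuous at \<open>a = 0\<close>, so the induction starts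
  from a single jump, which is treated directly. The jump has to occur not before \<open>x = a / C\<close>, and the probability that
  it occurs after \<open>y\<close> depends continuously on \<open>y\<close>.
\<close>
lemma stay_volume_one_jump:
  assumes N: "poisson_process M rate N" and t: "0 \<le> t" and \<beta>: "0 \<le> \<beta>" "\<beta> \<le> c1 * t"
  shows "stay_volume M rate N 0 1 t \<beta> = c2 * t + \<beta>"
proof -
  interpret prob_space M using N by (rule poisson_process_prob_space)
  have rate: "0 < rate" using N by (simp add: poisson_process_def)
  define C where "C = c1 + c2"
  have C: "0 < C" using c1_pos c2_pos by (simp add: C_def)
  define x where "x = (c1 * t - \<beta>) / C"
  have Cx: "C * x = c1 * t - \<beta>" using C by (simp add: x_def)
  have x: "0 \<le> x" "x \<le> t"
  proof -
    have "0 \<le> c2 * t + \<beta>" using \<beta> t c2_pos by simp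
    then have "c1 * t - \<beta> \<le> t * C" by (simp add: C_def algebra_simps)
    then show "x \<le> t" using C by (simp add: x_def pos_divide_le_eq)
    show "0 \<le> x" using \<beta> C by (simp add: x_def)
  qed
  let ?K = "exp (rate * t) * (C / rate)"
  let ?E = "{\<omega> \<in> space M. N t \<omega> = 1 \<and> stays_below 0 (\<lambda>u. N u \<omega>) t \<beta>}"
  let ?F = "\<lambda>y. {\<omega> \<in> space M. N y \<omega> = 0 \<and> N t \<omega> = 1}"
  have K: "0 \<le> ?K" using C rate by simp
  have F_events: "?F y \<in> events" if "0 \<le> y" for y
  proof -
    have "?F y = {\<omega> \<in> space M. N y \<omega> = 0} \<inter> {\<omega> \<in> space M. N t \<omega> = 1}" by auto
    then show ?thesis
      by (simp only:) (intro sets.Int count_event_sets[OF N that] count_event_sets[OF N t])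
  qed
  have V: "stay_volume M rate N 0 1 t \<beta> = ?K * prob ?E"
    by (simp add: stay_volume_def stay_prob_def C_def)
  have "?F x \<subseteq> ?E"
    using late_jump_imp_stay[OF poisson_process_mono[OF N] x poisson_process_zero[OF N] _ \<beta>(1)] Cx
    by (auto simp: C_def)
  then have "?K * prob (?F x) \<le> ?K * prob ?E"
    by (intro mult_left_mono K finite_measure_mono stay_event_sets[OF N t])
  then have lower: "C * (t - x) \<le> stay_volume M rate N 0 1 t \<beta>"
    using volume_late_single_jump[OF N x] V by (simp add: C_def)
  have "stay_volume M rate N 0 1 t \<beta> \<le> C * (t - x) + e" if "0 < e" for e
  proof -
    define y where "y = max 0 (x - e / C)"
    have y: "0 \<le> y" "y \<le> t" "y = 0 \<or> y < x" "C * x - e \<le> C * y"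
    proof -
      have "C * (x - e / C) \<le> C * y" using C by (simp add: y_def)
      then show "C * x - e \<le> C * y" using C by (simp add: right_diff_distrib)
      have "0 < e / C" using that C by simp
      then show "0 \<le> y" "y \<le> t" "y = 0 \<or> y < x" using x by (auto simp: y_def)
    qed
    have "?E \<subseteq> ?F y"
    proof
      fix \<omega> assume \<omega>: "\<omega> \<in> ?E"
      show "\<omega> \<in> ?F y"
      proof (cases "y = 0")
        case True
        then show ?thesis using \<omega> poisson_process_zero[OF N] by auto
      next
        case False
        then have "C * y < C * x" using y(3) C by simp
        then show ?thesis
          using \<omega> one_jump_stay_imp_no_early_jump[OF poisson_process_mono[OF N] y(1,2), of \<omega> \<beta>] Cx
          by (auto simp: C_def)
      qed
    qed
    then have "?K * prob ?E \<le> ?K * prob (?F y)"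
      by (intro mult_left_mono K finite_measure_mono F_events y)
    then have "stay_volume M rate N 0 1 t \<beta> \<le> C * (t - y)"
      using volume_late_single_jump[OF N y(1,2)] V by (simp add: C_def)
    then show ?thesis using y(4) by (simp add: algebra_simps)
  qed
  then have "stay_volume M rate N 0 1 t \<beta> \<le> C * (t - x)"
    by (rule field_le_epsilon)
  then have "stay_volume M rate N 0 1 t \<beta> = C * t - C * x"
    using lower by (simp add: right_diff_distrib)
  then show ?thesis by (simp add: Cx) (simp add: C_def algebra_simps)
qed

end

section \<open>Induction over the number of jumps\<close>

context telegraph_speeds begin

text \<open>By right-continuity the first jump occurs at a positive time, and until then the particle rises.\<close>
lemma no_stay_at_level_zero:
  assumes N: "poisson_process M rate N" and t: "0 \<le> t"
  shows "stay_volume M rate N 1 (Suc n) t 0 = 0"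
proof -
  have False if \<omega>: "\<omega> \<in> space M" "N t \<omega> = Suc n" "stays_below 1 (\<lambda>u. N u \<omega>) t 0" for \<omega>
  proof -
    have "0 < t"
      using \<omega> t poisson_process_zero[OF N \<omega>(1)] by (cases "t = 0") auto
    from poisson_process_right_continuous[OF N \<omega>(1), of 0]
    obtain b where b: "0 < b" "\<And>y. 0 < y \<Longrightarrow> y < b \<Longrightarrow> N y \<omega> = N 0 \<omega>"
      by (auto simp: continuous_at_right_discrete_iff)
    define s where "s = min b t"
    have s: "0 < s" "s \<le> b" "s \<le> t" using b(1) \<open>0 < t\<close> by (auto simp: s_def)
    have "disp 1 (\<lambda>u. N u \<omega>) s = vel (1 + 0) * s"
    proof (rule disp_constant_velocity)
      show "N u \<omega> = 0" if "0 \<le> u" "u < s" for u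
        using b(2)[of u] that s poisson_process_zero[OF N \<omega>(1)] by (cases "u = 0") auto
    qed (use s in simp)
    then have "0 < disp 1 (\<lambda>u. N u \<omega>) s"
      using s c1_pos by (simp add: vel_def)
    moreover have "disp 1 (\<lambda>u. N u \<omega>) s \<le> 0"
      using \<omega>(3) s by (auto simp: stays_below_def)
    ultimately show False by simp
  qed
  then have "{\<omega> \<in> space M. N t \<omega> = Suc n \<and> stays_below 1 (\<lambda>u. N u \<omega>) t 0} = {}"
    by blast
  then show ?thesis unfolding stay_volume_def stay_prob_def by (simp only: measure_empty mult_zero_right)
qed

text \<open>
  The line \<open>a = const\<close> is followed until the level is reached at \<open>x = \<beta> / c1\<close>. In the upper bound
  the coordinate \<open>a - C * h\<close> may become negative. The level is then out of reach, and the volume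
  \<open>(C * t) ^ n\<close> is at most \<open>b ^ n\<close>, the value of the polynomial at \<open>a = 0\<close>.
\<close>
lemma start_up_volume:
  assumes IH: "\<And>N t \<beta>. poisson_process M rate N \<Longrightarrow> 0 \<le> t \<Longrightarrow> 0 \<le> \<beta> \<Longrightarrow> \<beta> \<le> c1 * t \<Longrightarrow>
      stay_volume M rate N 0 (2 * k + 1) t \<beta> = down_poly k (c1 * t - \<beta>) (c2 * t + \<beta>)"
    and N: "poisson_process M rate N" and t: "0 \<le> t" and \<beta>: "0 \<le> \<beta>" "\<beta> \<le> c1 * t"
  shows "stay_volume M rate N 1 (2 * Suc k) t \<beta> = up_poly (Suc k) (c1 * t - \<beta>) (c2 * t + \<beta>)"
proof -
  define C where "C = c1 + c2"
  define a where "a = c1 * t - \<beta>"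
  define b where "b = c2 * t + \<beta>"
  define x where "x = \<beta> / c1"
  have C: "0 < C" using c1_pos c2_pos by (simp add: C_def)
  have ab: "0 \<le> a" "0 \<le> b" "a + b = C * t"
    using \<beta> t c2_pos by (simp_all add: a_def b_def C_def algebra_simps)
  have x: "0 \<le> x" "x \<le> t" "c1 * x = \<beta>"
    using \<beta> c1_pos by (simp_all add: x_def pos_divide_le_eq mult.commute)
  have v1: "vel 1 = c1" by (simp add: vel_def)
  have Cs: "0 \<le> b - C * s" if "s \<le> x" for s
  proof -
    have "C * s \<le> C * x" using that C by simp
    also have "C * x = \<beta> + c2 * x" using x(3) by (simp add: C_def algebra_simps)
    also have "\<dots> \<le> b" using x(2) c2_pos by (simp add: b_def)
    finally show ?thesis by simp
  qed
  have level: "0 \<le> \<beta> - c1 * s" if "s \<le> x" for s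
    using that x(3) c1_pos by (metis diff_ge_0_iff_ge mult_le_cancel_left_pos)
  have "stay_volume M rate N 1 (Suc (2 * k + 1)) t \<beta> = up_poly (Suc k) a (b - C * 0)"
  proof (rule stay_volume_along_characteristic[OF N x(1,2), where g="\<lambda>s. down_poly k a (b - C * s)"
        and G="\<lambda>s. up_poly (Suc k) a (b - C * s)"])
    show "0 \<le> \<beta> - vel 1 * s" if "s \<le> x" for s
      unfolding v1 by (rule level[OF that])
    show "((\<lambda>s. up_poly (Suc k) a (b - C * s)) has_real_derivative
        - (real (Suc (2 * k + 1)) * (c1 + c2) * down_poly k a (b - C * s))) (at s)" for s
    proof -
      have "((\<lambda>s. up_poly (Suc k) a (b - C * s)) has_real_derivative
          real (2 * k + 2) * down_poly k a (b - C * s) * (- C)) (at s)"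
        by (rule DERIV_chain2[OF up_poly_deriv]) (auto intro!: derivative_eq_intros)
      then show ?thesis by (simp add: C_def algebra_simps)
    qed
    show "continuous_on {0..x} (\<lambda>s. down_poly k a (b - C * s))"
      by (intro continuous_intros)
    show "stay_volume M rate (restart x N) 1 (Suc (2 * k + 1)) (t - x) (\<beta> - vel 1 * x)
        = up_poly (Suc k) a (b - C * x)"
    proof -
      have "b - C * x = (c2 / c1) * a"
        using c1_pos by (simp add: b_def C_def a_def x_def field_simps)
      then have "up_poly (Suc k) a (b - C * x) = 0"
        by (simp only: up_poly_zero)
      moreover have "\<beta> - vel 1 * x = 0" using x(3) v1 by simp
      ultimately show ?thesis
        using no_stay_at_level_zero[OF poisson_process_restart[OF N x(1)], of "t - x" "2 * k + 1"] x(2)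
        by simp
    qed
  next
    fix \<epsilon> :: real assume "0 < \<epsilon>"
    have cont: "continuous_on UNIV (\<lambda>p. down_poly k (fst p) (snd p))"
      by (intro continuous_intros)
    obtain \<delta> where \<delta>: "0 < \<delta>" "\<And>a' a'' b' b''. a' \<in> {0..a} \<Longrightarrow> a'' \<in> {0..a} \<Longrightarrow> b' \<in> {0..b} \<Longrightarrow> b'' \<in> {0..b} \<Longrightarrow>
       \<bar>a' - a''\<bar> + \<bar>b' - b''\<bar> < \<delta> \<Longrightarrow> \<bar>down_poly k a' b' - down_poly k a'' b''\<bar> < \<epsilon>"
      using uniformly_close_on_box[OF cont \<open>0 < \<epsilon>\<close>, of a b] by metis
    have box: "a \<in> {0..a}" "b - C * s \<in> {0..b}" if "0 \<le> s" "s \<le> x" for s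
      using ab that Cs[of s] C by auto
    have small: "C * h < \<delta>" if "h < \<delta> / C" for h
      using that C by (simp add: pos_less_divide_eq mult.commute)
    show "\<exists>\<delta>>0. \<forall>s h. 0 \<le> s \<and> 0 < h \<and> h < \<delta> \<and> s + h \<le> x \<longrightarrow>
        stay_volume M rate (restart (s + h) N) (Suc 1) (2 * k + 1) (t - (s + h)) (\<beta> - vel 1 * s + c2 * h)
        \<le> down_poly k a (b - C * s) + \<epsilon>"
    proof (intro exI[of _ "\<delta> / C"] conjI allI impI)
      show "0 < \<delta> / C" using \<delta>(1) C by simp
      fix s h assume asm: "0 \<le> s \<and> 0 < h \<and> h < \<delta> / C \<and> s + h \<le> x"
      let ?t = "t - (s + h)" and ?\<beta> = "\<beta> - c1 * s + c2 * h"
      have rN: "poisson_process M rate (restart (s + h) N)"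
        using asm by (intro poisson_process_restart[OF N]) auto
      have t': "0 \<le> ?t" using asm x by auto
      have Ch: "0 < C * h" "C * h < \<delta>" using asm small C by auto
      note boxs = box[of s]
      have a': "c1 * ?t - ?\<beta> = a - C * h" "c2 * ?t + ?\<beta> = b - C * s"
        by (simp_all add: a_def b_def C_def algebra_simps)
      have "stay_volume M rate (restart (s + h) N) 0 (2 * k + 1) ?t ?\<beta> \<le> down_poly k a (b - C * s) + \<epsilon>"
      proof (cases "C * h \<le> a")
        case True
        have "0 \<le> ?\<beta>" using level[of s] asm c2_pos by (intro add_nonneg_nonneg) auto
        then have "stay_volume M rate (restart (s + h) N) 0 (2 * k + 1) ?t ?\<beta> = down_poly k (a - C * h) (b - C * s)"
          using IH[OF rN t' \<open>0 \<le> ?\<beta>\<close>] a' True by (simp del: mult_Suc_right)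
        moreover have "\<bar>down_poly k (a - C * h) (b - C * s) - down_poly k a (b - C * s)\<bar> < \<epsilon>"
          using True Ch asm boxs by (intro \<delta>(2)) auto
        ultimately show ?thesis by linarith
      next
        case False
        have eq: "C * ?t = a - C * h + (b - C * s)"
          using a' by (simp add: C_def algebra_simps)
        have "stay_volume M rate (restart (s + h) N) 0 (2 * k + 1) ?t ?\<beta> \<le> (C * ?t) ^ (2 * k + 1)"
          unfolding C_def by (rule stay_volume_le_total[OF rN t'])
        also have "\<dots> \<le> (b - C * s) ^ (2 * k + 1)"
        proof (rule power_mono)
          show "C * ?t \<le> b - C * s" using False eq by linarith
          show "0 \<le> C * ?t" using t' C by simp
        qed
        also have "\<dots> = down_poly k 0 (b - C * s)"
          by (simp add: down_poly_zero)
        finally have "stay_volume M rate (restart (s + h) N) 0 (2 * k + 1) ?t ?\<beta> \<le> down_poly k 0 (b - C * s)" .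
        moreover have "\<bar>down_poly k 0 (b - C * s) - down_poly k a (b - C * s)\<bar> < \<epsilon>"
          using False Ch asm boxs ab by (intro \<delta>(2)) auto
        ultimately show ?thesis by linarith
      qed
      then show "stay_volume M rate (restart (s + h) N) (Suc 1) (2 * k + 1) ?t (\<beta> - vel 1 * s + c2 * h)
          \<le> down_poly k a (b - C * s) + \<epsilon>"
        unfolding v1 unfolding One_nat_def stay_volume_cong_parity .
    qed
    show "\<exists>\<delta>>0. \<forall>s h. 0 \<le> s \<and> 0 < h \<and> h < \<delta> \<and> s + h \<le> x \<longrightarrow>
        down_poly k a (b - C * s) - \<epsilon> \<le>
        stay_volume M rate (restart (s + h) N) (Suc 1) (2 * k + 1) (t - (s + h)) (\<beta> - vel 1 * s - c1 * h)"
    proof (intro exI[of _ "\<delta> / C"] conjI allI impI)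
      show "0 < \<delta> / C" using \<delta>(1) C by simp
      fix s h assume asm: "0 \<le> s \<and> 0 < h \<and> h < \<delta> / C \<and> s + h \<le> x"
      let ?t = "t - (s + h)" and ?\<beta> = "\<beta> - c1 * s - c1 * h"
      have rN: "poisson_process M rate (restart (s + h) N)"
        using asm by (intro poisson_process_restart[OF N]) auto
      have t': "0 \<le> ?t" using asm x by auto
      have Ch: "0 < C * h" "C * h < \<delta>" using asm small C by auto
      have a': "c1 * ?t - ?\<beta> = a" "c2 * ?t + ?\<beta> = b - C * (s + h)"
        by (simp_all add: a_def b_def C_def algebra_simps)
      have \<beta>': "0 \<le> ?\<beta>" "?\<beta> \<le> c1 * ?t"
        using level[of "s + h"] asm a'(1) ab(1) by (simp_all add: algebra_simps)
      have "stay_volume M rate (restart (s + h) N) 0 (2 * k + 1) ?t ?\<beta> = down_poly k a (b - C * (s + h))"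
        using IH[OF rN t' \<beta>'] unfolding a' .
      moreover have "\<bar>down_poly k a (b - C * s) - down_poly k a (b - C * (s + h))\<bar> < \<epsilon>"
      proof (rule \<delta>(2))
        show "\<bar>a - a\<bar> + \<bar>b - C * s - (b - C * (s + h))\<bar> < \<delta>"
          using Ch by (simp add: distrib_left)
      qed (use box[of s] box[of "s + h"] asm in auto)
      ultimately show "down_poly k a (b - C * s) - \<epsilon> \<le>
          stay_volume M rate (restart (s + h) N) (Suc 1) (2 * k + 1) ?t (\<beta> - vel 1 * s - c1 * h)"
        unfolding v1 unfolding One_nat_def stay_volume_cong_parity by linarith
    qed
  qed
  then show ?thesis by (simp add: a_def b_def)
qed

text \<open>
  The line \<open>b = const\<close> is followed until the level gets out of reach at \<open>x = a / C\<close>. In the lower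
  bound the level \<open>\<beta> + c2 * s - c1 * h\<close> may become negative. Then \<open>b\<close> is within \<open>C * h\<close> of
  \<open>r * a\<close>, where the polynomial vanishes, so its value is small and the trivial bound \<open>0\<close> suffices.
\<close>
lemma start_down_volume_step:
  assumes IH: "\<And>N t \<beta>. poisson_process M rate N \<Longrightarrow> 0 \<le> t \<Longrightarrow> 0 \<le> \<beta> \<Longrightarrow> \<beta> \<le> c1 * t \<Longrightarrow>
      stay_volume M rate N 1 (2 * k) t \<beta> = up_poly k (c1 * t - \<beta>) (c2 * t + \<beta>)"
    and N: "poisson_process M rate N" and t: "0 \<le> t" and \<beta>: "0 \<le> \<beta>" "\<beta> \<le> c1 * t"
  shows "stay_volume M rate N 0 (2 * k + 1) t \<beta> = down_poly k (c1 * t - \<beta>) (c2 * t + \<beta>)"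
proof -
  have rate: "0 < rate" using N by (simp add: poisson_process_def)
  define C where "C = c1 + c2"
  define r where "r = c2 / c1"
  define a where "a = c1 * t - \<beta>"
  define b where "b = c2 * t + \<beta>"
  define x where "x = a / C"
  have C: "0 < C" using c1_pos c2_pos by (simp add: C_def)
  have r: "0 \<le> r" "c1 * r = c2" using c1_pos c2_pos by (simp_all add: r_def)
  have ab: "0 \<le> a" "0 \<le> b" "a + b = C * t"
    using \<beta> t c2_pos by (simp_all add: a_def b_def C_def algebra_simps)
  have x: "0 \<le> x" "x \<le> t" "C * x = a"
    using ab C by (simp_all add: x_def pos_divide_le_eq mult.commute)
  have v0: "vel 0 = - c2" by (simp add: vel_def)
  have as: "0 \<le> a - C * s" if "s \<le> x" for s
    using that x(3) C by (metis diff_ge_0_iff_ge mult_le_cancel_left_pos)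
  have "stay_volume M rate N 0 (Suc (2 * k)) t \<beta> = down_poly k (a - C * 0) b"
  proof (rule stay_volume_along_characteristic[OF N x(1,2), where g="\<lambda>s. up_poly k (a - C * s) b"
        and G="\<lambda>s. down_poly k (a - C * s) b"])
    show "0 \<le> \<beta> - vel 0 * s" if "0 \<le> s" for s
      using that \<beta>(1) c2_pos by (simp add: v0)
    show "((\<lambda>s. down_poly k (a - C * s) b) has_real_derivative
        - (real (Suc (2 * k)) * (c1 + c2) * up_poly k (a - C * s) b)) (at s)" for s
    proof -
      have "((\<lambda>s. down_poly k (a - C * s) b) has_real_derivative
          real (2 * k + 1) * up_poly k (a - C * s) b * (- C)) (at s)"
        by (rule DERIV_chain2[OF down_poly_deriv]) (auto intro!: derivative_eq_intros)
      then show ?thesis by (simp add: C_def algebra_simps)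
    qed
    show "continuous_on {0..x} (\<lambda>s. up_poly k (a - C * s) b)"
      by (intro continuous_intros)
    show "stay_volume M rate (restart x N) 0 (Suc (2 * k)) (t - x) (\<beta> - vel 0 * x)
        = down_poly k (a - C * x) b"
    proof -
      have e: "c1 * (t - x) = \<beta> - vel 0 * x" "C * (t - x) = b"
        using x(3) ab by (simp_all add: a_def C_def v0 algebra_simps)
      have "stay_volume M rate (restart x N) 0 (Suc (2 * k)) (t - x) (\<beta> - vel 0 * x) = (C * (t - x)) ^ Suc (2 * k)"
        unfolding C_def
        by (rule stay_volume_total[OF poisson_process_restart[OF N x(1)]]) (use x e in auto)
      then show ?thesis by (simp add: x(3) e down_poly_zero)
    qed
  next
    fix \<epsilon> :: real assume "0 < \<epsilon>"
    have cont: "continuous_on UNIV (\<lambda>p. up_poly k (fst p) (snd p))"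
      by (intro continuous_intros)
    obtain \<delta> where \<delta>: "0 < \<delta>" "\<And>a' a'' b' b''. a' \<in> {0..a} \<Longrightarrow> a'' \<in> {0..a} \<Longrightarrow> b' \<in> {0..b} \<Longrightarrow> b'' \<in> {0..b} \<Longrightarrow>
       \<bar>a' - a''\<bar> + \<bar>b' - b''\<bar> < \<delta> \<Longrightarrow> \<bar>up_poly k a' b' - up_poly k a'' b''\<bar> < \<epsilon>"
      using uniformly_close_on_box[OF cont \<open>0 < \<epsilon>\<close>, of a b] by metis
    have box: "a - C * s \<in> {0..a}" "b \<in> {0..b}" if "0 \<le> s" "s \<le> x" for s
      using ab that as[of s] C by auto
    have small: "C * h < \<delta>" if "h < \<delta> / C" for h
      using that C by (simp add: pos_less_divide_eq mult.commute)
    show "\<exists>\<delta>>0. \<forall>s h. 0 \<le> s \<and> 0 < h \<and> h < \<delta> \<and> s + h \<le> x \<longrightarrow>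
        stay_volume M rate (restart (s + h) N) (Suc 0) (2 * k) (t - (s + h)) (\<beta> - vel 0 * s + c2 * h)
        \<le> up_poly k (a - C * s) b + \<epsilon>"
    proof (intro exI[of _ "\<delta> / C"] conjI allI impI)
      show "0 < \<delta> / C" using \<delta>(1) C by simp
      fix s h assume asm: "0 \<le> s \<and> 0 < h \<and> h < \<delta> / C \<and> s + h \<le> x"
      let ?t = "t - (s + h)" and ?\<beta> = "\<beta> - vel 0 * s + c2 * h"
      have rN: "poisson_process M rate (restart (s + h) N)"
        using asm by (intro poisson_process_restart[OF N]) auto
      have t': "0 \<le> ?t" using asm x by auto
      have Ch: "0 < C * h" "C * h < \<delta>" using asm small C by auto
      have a': "c1 * ?t - ?\<beta> = a - C * (s + h)" "c2 * ?t + ?\<beta> = b"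
        by (simp_all add: a_def b_def C_def v0 algebra_simps)
      have "0 \<le> ?\<beta>" using asm \<beta>(1) c2_pos by (simp add: v0)
      moreover have "?\<beta> \<le> c1 * ?t"
        using as[of "s + h"] asm a'(1) by linarith
      ultimately have "stay_volume M rate (restart (s + h) N) 1 (2 * k) ?t ?\<beta> = up_poly k (a - C * (s + h)) b"
        using IH[OF rN t'] a' by metis
      moreover have "\<bar>up_poly k (a - C * (s + h)) b - up_poly k (a - C * s) b\<bar> < \<epsilon>"
      proof (rule \<delta>(2))
        show "\<bar>a - C * (s + h) - (a - C * s)\<bar> + \<bar>b - b\<bar> < \<delta>"
          using Ch by (simp add: distrib_left)
      qed (use box[of s] box[of "s + h"] asm in auto)
      ultimately show "stay_volume M rate (restart (s + h) N) (Suc 0) (2 * k) ?t ?\<beta>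
          \<le> up_poly k (a - C * s) b + \<epsilon>"
        unfolding One_nat_def by linarith
    qed
    show "\<exists>\<delta>>0. \<forall>s h. 0 \<le> s \<and> 0 < h \<and> h < \<delta> \<and> s + h \<le> x \<longrightarrow>
        up_poly k (a - C * s) b - \<epsilon> \<le>
        stay_volume M rate (restart (s + h) N) (Suc 0) (2 * k) (t - (s + h)) (\<beta> - vel 0 * s - c1 * h)"
    proof (intro exI[of _ "\<delta> / C"] conjI allI impI)
      show "0 < \<delta> / C" using \<delta>(1) C by simp
      fix s h assume asm: "0 \<le> s \<and> 0 < h \<and> h < \<delta> / C \<and> s + h \<le> x"
      let ?t = "t - (s + h)" and ?\<beta> = "\<beta> - vel 0 * s - c1 * h"
      have rN: "poisson_process M rate (restart (s + h) N)"
        using asm by (intro poisson_process_restart[OF N]) auto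
      have t': "0 \<le> ?t" using asm x by auto
      have Ch: "0 < C * h" "C * h < \<delta>" using asm small C by auto
      have a': "c1 * ?t - ?\<beta> = a - C * s" "c2 * ?t + ?\<beta> = b - C * h"
        by (simp_all add: a_def b_def C_def v0 algebra_simps)
      have as': "0 \<le> a - C * s" using as[of s] asm by auto
      have level: "c1 * (b - C * h - r * (a - C * s)) = C * ?\<beta>"
      proof -
        have "c1 * (b - C * h - r * (a - C * s)) = c1 * (b - C * h) - c1 * r * (a - C * s)"
          by (simp add: algebra_simps)
        also have "\<dots> = c1 * (c2 * ?t + ?\<beta>) - c2 * (c1 * ?t - ?\<beta>)"
          unfolding a' r(2) ..
        finally show ?thesis by (simp add: C_def algebra_simps)
      qed
      show "up_poly k (a - C * s) b - \<epsilon> \<le> stay_volume M rate (restart (s + h) N) (Suc 0) (2 * k) ?t ?\<beta>"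
      proof (cases "0 \<le> ?\<beta>")
        case True
        then have "0 \<le> c1 * (b - C * h - r * (a - C * s))" using level C by simp
        then have "r * (a - C * s) \<le> b - C * h"
          using c1_pos by (simp add: zero_le_mult_iff)
        moreover have "0 \<le> r * (a - C * s)" using r as' by simp
        ultimately have bh: "0 \<le> b - C * h" by simp
        have "stay_volume M rate (restart (s + h) N) 1 (2 * k) ?t ?\<beta> = up_poly k (a - C * s) (b - C * h)"
          using IH[OF rN t' True] a' as' by (metis diff_ge_0_iff_ge)
        moreover have "\<bar>up_poly k (a - C * s) b - up_poly k (a - C * s) (b - C * h)\<bar> < \<epsilon>"
          using box[of s] asm bh Ch by (intro \<delta>(2)) auto
        ultimately show ?thesis unfolding One_nat_def by linarith
      next
        case False
        then have "c1 * (b - C * h - r * (a - C * s)) < 0"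
          using level C by (simp add: mult_pos_neg)
        then have 1: "b - C * h < r * (a - C * s)"
          using c1_pos by (simp add: mult_less_0_iff)
        have "c1 * (r * (a - C * s)) \<le> c1 * b"
        proof -
          have "c1 * b - c1 * r * (a - C * s) = C * (\<beta> - vel 0 * s)"
            unfolding r(2) by (simp add: a_def b_def C_def v0 algebra_simps)
          moreover have "0 \<le> C * (\<beta> - vel 0 * s)"
            using C \<beta>(1) asm c2_pos by (simp add: v0)
          ultimately show ?thesis by (simp add: mult.assoc)
        qed
        then have 2: "r * (a - C * s) \<le> b" using c1_pos by simp
        have "0 \<le> r * (a - C * s)" using r as' by simp
        then have "\<bar>up_poly k (a - C * s) b - up_poly k (a - C * s) (r * (a - C * s))\<bar> < \<epsilon>"
          using box[of s] asm 1 2 Ch by (intro \<delta>(2)) auto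
        moreover have "up_poly k (a - C * s) (r * (a - C * s)) = 0"
          unfolding r_def by (rule up_poly_zero)
        ultimately show ?thesis
          using stay_volume_nonneg[OF rate, of M "restart (s + h) N" "Suc 0" "2 * k" ?t ?\<beta>] by linarith
      qed
    qed
  qed
  then show ?thesis by (simp add: a_def b_def)
qed

lemma start_down_volume:
  assumes "poisson_process M rate N" "0 \<le> t" "0 \<le> \<beta>" "\<beta> \<le> c1 * t"
  shows "stay_volume M rate N 0 (2 * k + 1) t \<beta> = down_poly k (c1 * t - \<beta>) (c2 * t + \<beta>)"
  using assms
proof (induction k arbitrary: N t \<beta>)
  case 0
  then show ?case
    using stay_volume_one_jump[OF 0] by (simp add: down_poly_def binomial_head_def)
next
  case (Suc k)
  show ?case
    by (rule start_down_volume_step[OF start_up_volume[OF Suc.IH]]) (use Suc.prems in auto)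
qed

lemma start_down_prob:
  assumes N: "poisson_process M rate N" and t: "0 < t" and \<beta>: "0 \<le> \<beta>" "\<beta> \<le> c1 * t"
  shows "stay_prob M N 0 (2 * k + 1) t \<beta> / measure M {\<omega> \<in> space M. N t \<omega> = 2 * k + 1}
    = down_poly k (c1 * t - \<beta>) (c2 * t + \<beta>) / ((c1 + c2) * t) ^ (2 * k + 1)"
proof -
  have rate: "0 < rate" using N by (simp add: poisson_process_def)
  define K where "K = exp (rate * t) * fact (2 * k + 1) * ((c1 + c2) / rate) ^ (2 * k + 1)"
  have "K \<noteq> 0" using rate c1_pos c2_pos by (simp add: K_def)
  then have "stay_prob M N 0 (2 * k + 1) t \<beta> / measure M {\<omega> \<in> space M. N t \<omega> = 2 * k + 1}
    = (K * stay_prob M N 0 (2 * k + 1) t \<beta>) / (K * measure M {\<omega> \<in> space M. N t \<omega> = 2 * k + 1})"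
    by simp
  also have "K * stay_prob M N 0 (2 * k + 1) t \<beta> = down_poly k (c1 * t - \<beta>) (c2 * t + \<beta>)"
    unfolding K_def stay_volume_def[symmetric] using start_down_volume[OF N _ \<beta>] t by simp
  also have "K * measure M {\<omega> \<in> space M. N t \<omega> = 2 * k + 1} = ((c1 + c2) * t) ^ (2 * k + 1)"
    unfolding K_def by (rule stay_volume_count[OF N]) (use t in simp)
  finally show ?thesis .
qed

lemma down_poly_expand:
  "down_poly k a b = (\<Sum>j=0..k. real ((2 * k + 1) choose j) * (a ^ j * b ^ (2 * k + 1 - j)))
    - (\<Sum>j<k. real ((2 * k + 1) choose j) * (c2 / c1) ^ (2 * k - 2 * j) * (a ^ (2 * k + 1 - j) * b ^ j))"
proof -
  let ?r = "c2 / c1"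
  have r: "?r \<noteq> 0" using c1_pos c2_pos by simp
  have cancel: "?r ^ (2 * k) * (b / ?r\<^sup>2) ^ j = ?r ^ (2 * k - 2 * j) * b ^ j" if "j < k" for j
  proof -
    have split: "?r ^ (2 * k) = ?r ^ (2 * k - 2 * j) * (?r\<^sup>2) ^ j"
      using that by (simp flip: power_add power_mult)
    have "(?r\<^sup>2) ^ j \<noteq> 0" using r by simp
    moreover have "u * y * (c / y) = u * c" if "y \<noteq> 0" for u y c :: real
      using that by simp
    ultimately show ?thesis
      by (simp only: split power_divide[of b "?r\<^sup>2" j])
  qed
  have regroup: "x * (B * (y * A)) = B * A * (x * y)" "B * z * (A * w) = B * A * (z * w)"
    for x y z w A B :: real
    by simp_all
  have "?r ^ (2 * k) * binomial_head (2 * k + 1) k (b / ?r\<^sup>2) a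
      = (\<Sum>j<k. real ((2 * k + 1) choose j) * ?r ^ (2 * k - 2 * j) * (a ^ (2 * k + 1 - j) * b ^ j))"
    unfolding binomial_head_def sum_distrib_left
    by (intro sum.cong refl) (simp only: lessThan_iff regroup cancel)
  moreover have "{..<k + 1} = {0..k}" by auto
  ultimately show ?thesis
    unfolding down_poly_def binomial_head_def by simp
qed

end

section \<open>The conditional law of the maximum\<close>

context telegraph_speeds begin

lemma switch_velocity_iterate: "(switch_velocity c1 c2 ^^ n) (- c2) = vel n"
  using c1_pos c2_pos by (induction n) (auto simp: switch_velocity_def vel_def)

lemma telegraph_position_eq_disp:
  "V0 \<omega> = - c2 \<Longrightarrow> telegraph_position c1 c2 V0 N s \<omega> = disp 0 (\<lambda>u. N u \<omega>) s"
  by (simp add: telegraph_position_def telegraph_velocity_def switch_velocity_iterate disp_def)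

lemma SUP_telegraph_position_le_iff:
  assumes "mono_on {0..} (\<lambda>u. N u \<omega>)" "V0 \<omega> = - c2" "0 \<le> t"
  shows "(SUP s\<in>{0..t}. telegraph_position c1 c2 V0 N s \<omega>) \<le> \<beta> \<longleftrightarrow>
    stays_below 0 (\<lambda>u. N u \<omega>) t \<beta>"
proof -
  have "disp 0 (\<lambda>u. N u \<omega>) s \<le> c1 * t" if "s \<in> {0..t}" for s
    using stays_below_trivial[OF assms(1), of t "c1 * t" 0] that by (simp add: stays_below_def)
  then have "bdd_above (disp 0 (\<lambda>u. N u \<omega>) ` {0..t})"
    by (rule bdd_aboveI2)
  then show ?thesis
    using \<open>0 \<le> t\<close> by (simp add: telegraph_position_eq_disp[of V0 \<omega>, OF assms(2)] stays_below_def cSUP_le_iff)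
qed

lemma prob_start_down_indep:
  assumes T: "telegraph_process M c1 c2 rate V0 N" and t: "0 \<le> t"
  shows "measure M {\<omega> \<in> space M. V0 \<omega> = - c2 \<and> N t \<omega> = n \<and> stays_below d (\<lambda>u. N u \<omega>) t \<beta>}
    = 1 / 2 * stay_prob M N d n t \<beta>"
proof -
  have N: "poisson_process M rate N" and half: "measure M {\<omega> \<in> space M. V0 \<omega> = - c2} = 1 / 2"
    using T by (auto simp: telegraph_process_def)
  interpret prob_space M using N by (rule poisson_process_prob_space)
  define path where "path = (\<lambda>\<omega>. \<lambda>t\<in>{0..}. N t \<omega>)"
  define F where "F = vimage_algebra (space M) path (PiM {0..} (\<lambda>_. count_space UNIV))"
  let ?E = "{\<omega> \<in> space M. N t \<omega> = n \<and> stays_below d (\<lambda>u. N u \<omega>) t \<beta>}"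
  have ind: "indep_set (sets (vimage_algebra (space M) V0 borel)) (sets F)"
    using T by (simp add: telegraph_process_def F_def path_def)
  have path: "path \<in> measurable F (PiM {0..} (\<lambda>_. count_space UNIV))"
    unfolding F_def by (rule measurable_vimage_algebra1) (auto simp: path_def space_PiM)
  have "?E \<in> sets F"
  proof (rule stay_event_measurable[OF N _ _ t])
    show "N u \<in> measurable F (count_space UNIV)" if "0 \<le> u" for u
    proof -
      have "(\<lambda>\<omega>. path \<omega> u) \<in> measurable F (count_space UNIV)"
        by (rule measurable_compose[OF path measurable_component_singleton]) (use that in simp)
      then show ?thesis using that by (simp add: path_def)
    qed
  qed (simp add: F_def)
  moreover have "V0 -` {- c2} \<inter> space M \<in> sets (vimage_algebra (space M) V0 borel)"
    by (rule in_vimage_algebra) simp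
  ultimately have "prob ((V0 -` {- c2} \<inter> space M) \<inter> ?E) = prob (V0 -` {- c2} \<inter> space M) * prob ?E"
    by (intro indep_setD[OF ind])
  moreover have "V0 -` {- c2} \<inter> space M = {\<omega> \<in> space M. V0 \<omega> = - c2}" by auto
  moreover have "{\<omega> \<in> space M. V0 \<omega> = - c2} \<inter> ?E
      = {\<omega> \<in> space M. V0 \<omega> = - c2 \<and> N t \<omega> = n \<and> stays_below d (\<lambda>u. N u \<omega>) t \<beta>}" by auto
  ultimately show ?thesis by (simp add: half stay_prob_def)
qed

end

theorem theorem3p2:
  fixes M :: "'a measure" and c1 c2 rate t \<beta> :: real
    and V0 :: "'a \<Rightarrow> real" and N :: "real \<Rightarrow> 'a \<Rightarrow> nat" and k :: nat
  assumes "telegraph_process M c1 c2 rate V0 N"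
    and "t > 0" and "0 \<le> \<beta>" and "\<beta> \<le> c1 * t"
  shows "\<P>(\<omega> in M. (SUP s\<in>{0..t}. telegraph_position c1 c2 V0 N s \<omega>) \<le> \<beta>
              \<bar> telegraph_velocity c1 c2 V0 N 0 \<omega> = - c2 \<and> N t \<omega> = 2 * k + 1)
    = (\<Sum>j=0..k. real ((2 * k + 1) choose j) *
         ((c1 * t - \<beta>) ^ j * (c2 * t + \<beta>) ^ (2 * k + 1 - j)) / ((c1 + c2) * t) ^ (2 * k + 1))
    - (\<Sum>j<k. real ((2 * k + 1) choose j) * (c2 / c1) ^ (2 * k - 2 * j) *
         ((c1 * t - \<beta>) ^ (2 * k + 1 - j) * (c2 * t + \<beta>) ^ j) / ((c1 + c2) * t) ^ (2 * k + 1))"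
proof -
  interpret telegraph_speeds c1 c2
    using assms(1) by unfold_locales (auto simp: telegraph_process_def)
  have N: "poisson_process M rate N"
    using assms(1) by (simp add: telegraph_process_def)
  have t: "0 \<le> t" using assms(2) by simp
  let ?n = "2 * k + 1"
  have start: "telegraph_velocity c1 c2 V0 N 0 \<omega> = V0 \<omega>" if "\<omega> \<in> space M" for \<omega>
    using poisson_process_zero[OF N that] by (simp add: telegraph_velocity_def)
  have SUP_le_iff: "(SUP s\<in>{0..t}. telegraph_position c1 c2 V0 N s \<omega>) \<le> \<beta> \<longleftrightarrow>
      stays_below 0 (\<lambda>u. N u \<omega>) t \<beta>" if "\<omega> \<in> space M" "V0 \<omega> = - c2" for \<omega>
    by (rule SUP_telegraph_position_le_iff) (use poisson_process_mono[OF N that(1)] that(2) t in auto)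
  have joint: "{\<omega> \<in> space M. (SUP s\<in>{0..t}. telegraph_position c1 c2 V0 N s \<omega>) \<le> \<beta> \<and>
        telegraph_velocity c1 c2 V0 N 0 \<omega> = - c2 \<and> N t \<omega> = ?n}
    = {\<omega> \<in> space M. V0 \<omega> = - c2 \<and> N t \<omega> = ?n \<and> stays_below 0 (\<lambda>u. N u \<omega>) t \<beta>}"
    using SUP_le_iff start by auto
  \<comment> \<open>The conditioning event is also of this form, for the level \<open>c1 * t\<close> that is never exceeded.\<close>
  have cond: "{\<omega> \<in> space M. telegraph_velocity c1 c2 V0 N 0 \<omega> = - c2 \<and> N t \<omega> = ?n}
    = {\<omega> \<in> space M. V0 \<omega> = - c2 \<and> N t \<omega> = ?n \<and> stays_below 0 (\<lambda>u. N u \<omega>) t (c1 * t)}"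
    using stays_below_trivial[OF poisson_process_mono[OF N]] start by auto
  have total: "stay_prob M N 0 ?n t (c1 * t) = measure M {\<omega> \<in> space M. N t \<omega> = ?n}"
    unfolding stay_prob_def
    by (rule arg_cong[where f="measure M"]) (use stays_below_trivial[OF poisson_process_mono[OF N]] in auto)
  have "\<P>(\<omega> in M. (SUP s\<in>{0..t}. telegraph_position c1 c2 V0 N s \<omega>) \<le> \<beta>
              \<bar> telegraph_velocity c1 c2 V0 N 0 \<omega> = - c2 \<and> N t \<omega> = ?n)
      = stay_prob M N 0 ?n t \<beta> / measure M {\<omega> \<in> space M. N t \<omega> = ?n}"
    unfolding cond_prob_def joint cond prob_start_down_indep[OF assms(1) t] total by simp
  also have "\<dots> = down_poly k (c1 * t - \<beta>) (c2 * t + \<beta>) / ((c1 + c2) * t) ^ ?n"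
    by (rule start_down_prob[OF N assms(2-4)])
  finally show ?thesis
    by (simp only: down_poly_expand diff_divide_distrib sum_divide_distrib)
qed

end
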